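(* Let $\lambda_0\in(0,1)$ be such that $\dim\mu_{\lambda_0}<1$. Then for every $\theta\in(0,1)$, for generic $\phi\in C^\theta$ the function $h_\phi(\lambda)=\int_{\mathbb{R}}\phi(x)\,d\mu_\lambda(x)$, $\lambda\in(0,1)$, is not differentiable at $\lambda_0$.
   Context: For $\lambda\in(0,1)$, $\mu_\lambda$ denotes the (unbiased) infinite Bernoulli convolution: the law of the random variable $X(\lambda)=\sum_{m=1}^\infty a_m\lambda^{m-1}$, where $a_1,a_2,\dots$ are i.i.d. taking the values $-1$ and $1$ with probability $\frac12$ each. The (upper) Hausdorff dimension of $\mu_{\lambda_0}$ is $\dim\mu_{\lambda_0}=\inf\{\dim_H(A):\mu_{\lambda_0}(A)=1\}$, where $\dim_H$ is Hausdorff dimension of subsets of $\mathbb{R}$. $C^\theta$ is the Banach space of bounded Hölder continuous functions $\phi:\mathbb{R}\to\mathbb{R}$ with exponent $\theta$, with norm $\|\phi\|_{C^\theta}=\sup_x|\phi(x)|+\sup_{x\ne y}\frac{|\phi(x)-\phi(y)|}{|x-y|^\theta}$. A property holds for generic $\phi\in C^\theta$ if it holds for all $\phi$ in a set containing a dense $G_\delta$ subset of $C^\theta$. *)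

theory Defs
  imports "HOL-Probability.Probability"
begin

section \<open>Bernoulli convolutions\<close>

definition coin_space :: "(nat \<Rightarrow> real) measure" where
  "coin_space = (\<Pi>\<^sub>M m\<in>UNIV. measure_pmf (pmf_of_set {- 1, 1}))"

text \<open>Coordinates are indexed from \<open>0\<close>, so \<open>a m\<close> is the sign $a_{m+1}$, with weight $\lambda^m$.\<close>

definition bernoulli_series :: "real \<Rightarrow> (nat \<Rightarrow> real) \<Rightarrow> real" where
  "bernoulli_series l a = (\<Sum>m. a m * l ^ m)"

definition bernoulli_convolution :: "real \<Rightarrow> real measure" where
  "bernoulli_convolution l = distr coin_space borel (bernoulli_series l)"

lemma prob_space_coin_space: "prob_space coin_space"
  unfolding coin_space_def by (intro prob_space_PiM prob_space_measure_pmf)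

lemma bernoulli_series_measurable [measurable]:
  "bernoulli_series l \<in> borel_measurable coin_space"
proof -
  have "(\<lambda>a. a m) \<in> borel_measurable coin_space" for m
  proof -
    have "(\<lambda>a. a m) \<in> coin_space \<rightarrow>\<^sub>M measure_pmf (pmf_of_set {- 1, 1 :: real})"
      unfolding coin_space_def by (rule measurable_component_singleton) simp
    then show ?thesis
      by (rule measurable_compose) simp
  qed
  then show ?thesis
    unfolding bernoulli_series_def by (intro borel_measurable_suminf borel_measurable_times) auto
qed

lemma sets_bernoulli_convolution [simp]: "sets (bernoulli_convolution l) = sets borel"
  by (simp add: bernoulli_convolution_def)

lemma prob_space_bernoulli_convolution: "prob_space (bernoulli_convolution l)"
  unfolding bernoulli_convolution_def
  by (intro prob_space.prob_space_distr prob_space_coin_space bernoulli_series_measurable)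

lemma AE_coin_space: "AE a in coin_space. \<forall>m. a m \<in> {- 1, 1}"
proof -
  interpret product_prob_space "\<lambda>_::nat. measure_pmf (pmf_of_set {- 1, 1 :: real})" UNIV
    by unfold_locales
  have "AE a in coin_space. a m \<in> {- 1, 1}" for m
    unfolding coin_space_def
    by (rule AE_component) (auto simp: AE_measure_pmf_iff)
  then show ?thesis
    by (simp add: AE_all_countable)
qed

lemma AE_bernoulli_series_sums:
  assumes "l \<in> {0<..<1}"
  shows "AE a in coin_space. (\<lambda>m. a m * l ^ m) sums bernoulli_series l a"
  using AE_coin_space
proof eventually_elim
  case (elim a)
  have "summable (\<lambda>m. a m * l ^ m)"
  proof (rule summable_comparison_test')
    show "summable (\<lambda>m. l ^ m)"
      using assms by (intro summable_geometric) auto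
    show "norm (a m * l ^ m) \<le> l ^ m" for m
      using elim[rule_format, of m] assms by (auto simp: abs_mult)
  qed
  then show ?case
    unfolding bernoulli_series_def by (rule summable_sums)
qed


section \<open>Hausdorff dimension\<close>

text \<open>
  The case distinction realises the conventions $0^0 = 1$ for nonempty sets and
  zero weight for the empty set; \<open>powr\<close> alone has \<open>0 powr 0 = 0\<close>.
\<close>

definition hausdorff_weight :: "real \<Rightarrow> 'a::metric_space set \<Rightarrow> ennreal" where
  "hausdorff_weight s U =
     (if U = {} then 0 else if s = 0 then 1 else ennreal (diameter U powr s))"

text \<open>The covering sets are required to be bounded because \<open>diameter\<close> is meaningful only then.\<close>

definition hausdorff_premeasure :: "real \<Rightarrow> real \<Rightarrow> 'a::metric_space set \<Rightarrow> ennreal" where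
  "hausdorff_premeasure s d A =
     (INF U \<in> {U :: nat \<Rightarrow> 'a set. A \<subseteq> (\<Union>i. U i) \<and> (\<forall>i. bounded (U i) \<and> diameter (U i) \<le> d)}.
        \<Sum>i. hausdorff_weight s (U i))"

definition hausdorff_measure :: "real \<Rightarrow> 'a::metric_space set \<Rightarrow> ennreal" where
  "hausdorff_measure s A = (SUP d \<in> {0<..}. hausdorff_premeasure s d A)"

definition hausdorff_dim :: "'a::metric_space set \<Rightarrow> ereal" where
  "hausdorff_dim A = (INF s \<in> {s. 0 \<le> s \<and> hausdorff_measure s A = 0}. ereal s)"

definition upper_hausdorff_dim_measure :: "'a::metric_space measure \<Rightarrow> ereal" where
  "upper_hausdorff_dim_measure M = (INF A \<in> {A \<in> sets M. emeasure M A = 1}. hausdorff_dim A)"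


section \<open>The space of bounded Hoelder functions\<close>

definition holder_space :: "real \<Rightarrow> (real \<Rightarrow> real) set" where
  "holder_space \<theta> =
     {\<phi>. bounded (range \<phi>) \<and> (\<exists>C. \<forall>x y. \<bar>\<phi> x - \<phi> y\<bar> \<le> C * \<bar>x - y\<bar> powr \<theta>)}"

definition holder_norm :: "real \<Rightarrow> (real \<Rightarrow> real) \<Rightarrow> real" where
  "holder_norm \<theta> \<phi> =
     (SUP x. \<bar>\<phi> x\<bar>) + (SUP (x, y) \<in> {(x, y). x \<noteq> y}. \<bar>\<phi> x - \<phi> y\<bar> / \<bar>x - y\<bar> powr \<theta>)"

text \<open>
  The value outside the space is irrelevant to the topology, but the locale
  \<open>Metric_space\<close> demands nonnegativity and symmetry on the whole type.
\<close>

definition holder_dist :: "real \<Rightarrow> (real \<Rightarrow> real) \<Rightarrow> (real \<Rightarrow> real) \<Rightarrow> real" where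
  "holder_dist \<theta> \<phi> \<psi> =
     (if \<phi> \<in> holder_space \<theta> \<and> \<psi> \<in> holder_space \<theta>
      then holder_norm \<theta> (\<lambda>x. \<phi> x - \<psi> x) else 0)"

definition holder_topology :: "real \<Rightarrow> (real \<Rightarrow> real) topology" where
  "holder_topology \<theta> = Metric_space.mtopology (holder_space \<theta>) (holder_dist \<theta>)"

lemma holder_space_bdd:
  assumes "\<phi> \<in> holder_space \<theta>"
  shows "bdd_above (range (\<lambda>x. \<bar>\<phi> x\<bar>))"
    and "bdd_above ((\<lambda>(x, y). \<bar>\<phi> x - \<phi> y\<bar> / \<bar>x - y\<bar> powr \<theta>) ` {(x, y). x \<noteq> y})"
proof -
  show "bdd_above (range (\<lambda>x. \<bar>\<phi> x\<bar>))"
  proof -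
    obtain B where "\<And>x. \<bar>\<phi> x\<bar> \<le> B"
      using assms unfolding holder_space_def bounded_iff by auto
    then show ?thesis
      by (rule bdd_aboveI2)
  qed
  obtain C where "\<And>x y. \<bar>\<phi> x - \<phi> y\<bar> \<le> C * \<bar>x - y\<bar> powr \<theta>"
    using assms unfolding holder_space_def by auto
  then show "bdd_above ((\<lambda>(x, y). \<bar>\<phi> x - \<phi> y\<bar> / \<bar>x - y\<bar> powr \<theta>) ` {(x, y). x \<noteq> y})"
    by (intro bdd_aboveI2[where M = C]) (auto simp: field_simps)
qed

lemma holder_space_diff:
  assumes "\<phi> \<in> holder_space \<theta>" "\<psi> \<in> holder_space \<theta>"
  shows "(\<lambda>x. \<phi> x - \<psi> x) \<in> holder_space \<theta>"
proof -
  obtain C D where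
    C: "\<And>x y. \<bar>\<phi> x - \<phi> y\<bar> \<le> C * \<bar>x - y\<bar> powr \<theta>" and
    D: "\<And>x y. \<bar>\<psi> x - \<psi> y\<bar> \<le> D * \<bar>x - y\<bar> powr \<theta>"
    using assms unfolding holder_space_def by auto
  have "\<bar>(\<phi> x - \<psi> x) - (\<phi> y - \<psi> y)\<bar> \<le> (C + D) * \<bar>x - y\<bar> powr \<theta>" for x y
    using C[of x y] D[of x y] unfolding distrib_right by linarith
  moreover have "bounded (range (\<lambda>x. \<phi> x - \<psi> x))"
    using assms unfolding holder_space_def by (auto intro: bounded_minus_comp)
  ultimately show ?thesis
    unfolding holder_space_def by blast
qed

lemma holder_norm_ge:
  assumes "\<phi> \<in> holder_space \<theta>"
  shows "\<bar>\<phi> x\<bar> \<le> holder_norm \<theta> \<phi>"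
proof -
  have "0 \<le> \<bar>\<phi> 0 - \<phi> 1\<bar> / \<bar>0 - 1\<bar> powr \<theta>"
    by simp
  also have "\<dots> \<le> (SUP (x, y) \<in> {(x, y). x \<noteq> y}. \<bar>\<phi> x - \<phi> y\<bar> / \<bar>x - y\<bar> powr \<theta>)"
    using cSUP_upper[OF _ holder_space_bdd(2)[OF assms], of "(0, 1)"] by simp
  finally show ?thesis
    using cSUP_upper[OF UNIV_I holder_space_bdd(1)[OF assms], of x]
    unfolding holder_norm_def by linarith
qed

lemma holder_norm_add_le:
  assumes "\<phi> \<in> holder_space \<theta>" "\<psi> \<in> holder_space \<theta>"
  shows "holder_norm \<theta> (\<lambda>x. \<phi> x + \<psi> x) \<le> holder_norm \<theta> \<phi> + holder_norm \<theta> \<psi>"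
proof -
  let ?q = "\<lambda>\<phi> (x, y). \<bar>\<phi> x - \<phi> y\<bar> / \<bar>x - y\<bar> powr \<theta>"
  let ?D = "{(x, y :: real). x \<noteq> y}"
  have "(SUP x. \<bar>\<phi> x + \<psi> x\<bar>) \<le> (SUP x. \<bar>\<phi> x\<bar>) + (SUP x. \<bar>\<psi> x\<bar>)"
  proof (rule cSUP_least)
    show "\<bar>\<phi> x + \<psi> x\<bar> \<le> (SUP x. \<bar>\<phi> x\<bar>) + (SUP x. \<bar>\<psi> x\<bar>)" for x
      using cSUP_upper[OF UNIV_I holder_space_bdd(1)[OF assms(1)], of x]
        cSUP_upper[OF UNIV_I holder_space_bdd(1)[OF assms(2)], of x]
      by linarith
  qed simp
  moreover have "(SUP p \<in> ?D. ?q (\<lambda>x. \<phi> x + \<psi> x) p) \<le> (SUP p \<in> ?D. ?q \<phi> p) + (SUP p \<in> ?D. ?q \<psi> p)"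
  proof (rule cSUP_least)
    have "(0, 1) \<in> ?D"
      by simp
    then show "?D \<noteq> {}"
      by blast
    fix p assume p: "p \<in> ?D"
    have "?q (\<lambda>x. \<phi> x + \<psi> x) p \<le> ?q \<phi> p + ?q \<psi> p"
      by (cases p) (auto simp: add_divide_distrib[symmetric] intro!: divide_right_mono)
    then show "?q (\<lambda>x. \<phi> x + \<psi> x) p \<le> (SUP p \<in> ?D. ?q \<phi> p) + (SUP p \<in> ?D. ?q \<psi> p)"
      using cSUP_upper[OF p holder_space_bdd(2)[OF assms(1)]]
        cSUP_upper[OF p holder_space_bdd(2)[OF assms(2)]]
      by linarith
  qed
  ultimately show ?thesis
    unfolding holder_norm_def by linarith
qed

lemma Metric_space_holder: "Metric_space (holder_space \<theta>) (holder_dist \<theta>)"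
proof
  fix \<phi> \<psi> \<eta>
  show "0 \<le> holder_dist \<theta> \<phi> \<psi>"
    using holder_norm_ge[OF holder_space_diff, of \<phi> \<theta> \<psi> 0]
    by (auto simp: holder_dist_def)
  show "holder_dist \<theta> \<phi> \<psi> = holder_dist \<theta> \<psi> \<phi>"
  proof -
    have "(\<lambda>x. \<bar>\<phi> x - \<psi> x\<bar>) = (\<lambda>x. \<bar>\<psi> x - \<phi> x\<bar>)"
      by (rule ext) (rule abs_minus_commute)
    moreover have "(\<lambda>(x, y). \<bar>\<phi> x - \<psi> x - (\<phi> y - \<psi> y)\<bar> / \<bar>x - y\<bar> powr \<theta>) =
        (\<lambda>(x, y). \<bar>\<psi> x - \<phi> x - (\<psi> y - \<phi> y)\<bar> / \<bar>x - y\<bar> powr \<theta>)"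
      by (auto simp: fun_eq_iff intro!: arg_cong2[where f = "(/)"])
    ultimately have "holder_norm \<theta> (\<lambda>x. \<phi> x - \<psi> x) = holder_norm \<theta> (\<lambda>x. \<psi> x - \<phi> x)"
      unfolding holder_norm_def by (simp only:)
    then show ?thesis
      unfolding holder_dist_def by (simp only: conj_commute)
  qed
  show "holder_dist \<theta> \<phi> \<psi> = 0 \<longleftrightarrow> \<phi> = \<psi>"
    if "\<phi> \<in> holder_space \<theta>" "\<psi> \<in> holder_space \<theta>"
  proof
    assume "holder_dist \<theta> \<phi> \<psi> = 0"
    then show "\<phi> = \<psi>"
      using holder_norm_ge[OF holder_space_diff[OF that]] that
      by (intro ext) (auto simp: holder_dist_def)
  next
    have "(0 :: real, 1 :: real) \<in> {(x, y). x \<noteq> y}"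
      by simp
    then have "{(x :: real, y). x \<noteq> y} \<noteq> {}"
      by blast
    then have "holder_norm \<theta> (\<lambda>x. 0) = 0"
      by (simp add: holder_norm_def case_prod_unfold)
    then show "\<phi> = \<psi> \<Longrightarrow> holder_dist \<theta> \<phi> \<psi> = 0"
      by (simp add: holder_dist_def)
  qed
  show "holder_dist \<theta> \<phi> \<eta> \<le> holder_dist \<theta> \<phi> \<psi> + holder_dist \<theta> \<psi> \<eta>"
    if "\<phi> \<in> holder_space \<theta>" "\<psi> \<in> holder_space \<theta>" "\<eta> \<in> holder_space \<theta>"
    using holder_norm_add_le[OF holder_space_diff[OF that(1,2)] holder_space_diff[OF that(2,3)]] that
    by (simp add: holder_dist_def)
qed

lemma topspace_holder_topology [simp]: "topspace (holder_topology \<theta>) = holder_space \<theta>"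
  unfolding holder_topology_def by (rule Metric_space.topspace_mtopology[OF Metric_space_holder])


section \<open>Generic properties\<close>

definition generic_in :: "'a topology \<Rightarrow> ('a \<Rightarrow> bool) \<Rightarrow> bool" where
  "generic_in X P \<longleftrightarrow>
     (\<exists>G. gdelta_in X G \<and> X closure_of G = topspace X \<and> G \<subseteq> {x \<in> topspace X. P x})"

end

theory Submission
  imports Defs
begin

text \<open>
  Write $h_\phi(\lambda) = \int \phi \, d\mu_\lambda$, $\mu = \mu_{\lambda_0}$, and let $Y$ be the derivative of
  $X(\lambda)$ at $\lambda_0$. By Baire's theorem in $C^\theta$ it suffices that no bound
  $|h_\phi(\lambda) - h_\phi(\lambda_0)| \le C (\lambda - \lambda_0) \|\phi\|$ holds for all $\phi$ and all $\lambda > \lambda_0$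
  close to $\lambda_0$. Assume such a bound. As $\lambda$ runs through $[\lambda_0, \lambda_0 + \epsilon]$, the point
  $X(\lambda)$ sweeps an interval of length about $\epsilon |Y|$ with nearly constant speed, so the average of
  $\mu_\lambda$ over this range is spread out at scale $\epsilon$. For $r$ slightly smaller than $\epsilon$ the assumed
  bound, tested on functions of norm $r^{-\theta}$, transfers this to $\mu$ with an error
  $\epsilon r^{-\theta}$, which is small because $\theta < 1$: outside a set of small measure,
  $\mu(B(x,r))$ is at most about $(r / \epsilon) \, \mu(B(x,\epsilon))$. Iterating over summably many scales gives
  $\mu(B(x,r)) \le K r^t$ on a set of positive measure, for any given $t < 1$; this contradicts $\dim \mu < 1$
  by the mass distribution principle.
\<close>

section \<open>Coin flips\<close>

text \<open>The position X(\<lambda>_0) and the speed Y are functions of the same signs, so they are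
  not independent and neither can be averaged out against the other. The counting is therefore done
  for each sign sequence separately: if |Y| is not too small, few of the sampled parameters bring
  the point near a given cell, and none at all unless X(\<lambda>_0) is already close to that cell.
  The latter event has probability at most \<mu>(B(x,\<rho>)), and here a bad point x helps: it
  satisfies \<mu>(B(x,\<rho>)) < \<rho>/(M r) \<mu>(B(x,r)). Since the small balls in different
  cells overlap only boundedly, their masses can be summed, although the large balls overlap
  heavily. Small values of |Y| are excluded by an elementary estimate: the probability of |Y| <
  exp(-T) is O(1/T), because sign flips produce a number of disjoint copies of this event
  proportional to T. The bound is weak, and it dictates how fast the scales must shrink. Only
  parameters to the right of \<lambda>_0 enter, since unbounded one-sided difference quotients
  already exclude a derivative.\<close>

definition flip_coord :: "nat \<Rightarrow> (nat \<Rightarrow> real) \<Rightarrow> nat \<Rightarrow> real" where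
  "flip_coord m a = a(m := - a m)"

lemma space_coin_space [simp]: "space coin_space = UNIV"
  by (simp add: coin_space_def space_PiM)

text \<open>The factors of \<open>coin_space\<close> carry the discrete sigma-algebra, so a map back
  into \<open>coin_space\<close> must have coordinates that are measurable in this stronger
  sense.\<close>

lemma measurable_coin_coord_count_space:
  "(\<lambda>a. a m) \<in> coin_space \<rightarrow>\<^sub>M count_space UNIV"
proof -
  have "(\<lambda>a. a m) \<in> coin_space \<rightarrow>\<^sub>M measure_pmf (pmf_of_set {- 1, 1 :: real})"
    unfolding coin_space_def by (rule measurable_component_singleton) simp
  then show ?thesis
    by (rule measurable_compose) simp
qed

lemma measurable_coin_coord [measurable]: "(\<lambda>a. a m) \<in> borel_measurable coin_space"
  by (rule measurable_compose[OF measurable_coin_coord_count_space]) simp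

lemma measurable_flip_coord [measurable]: "flip_coord m \<in> coin_space \<rightarrow>\<^sub>M coin_space"
proof -
  have "(\<lambda>a i. flip_coord m a i) \<in> coin_space \<rightarrow>\<^sub>M (\<Pi>\<^sub>M i\<in>UNIV. measure_pmf (pmf_of_set {- 1, 1 :: real}))"
  proof (rule measurable_PiM_single')
    fix i :: nat
    have "(\<lambda>a. if i = m then - a m else a i) \<in> coin_space \<rightarrow>\<^sub>M count_space UNIV"
      by (cases "i = m") (auto intro: measurable_compose[OF measurable_coin_coord_count_space])
    then show "(\<lambda>a. flip_coord m a i) \<in> coin_space \<rightarrow>\<^sub>M measure_pmf (pmf_of_set {- 1, 1 :: real})"
      by (simp add: flip_coord_def fun_upd_def)
  qed auto
  then show ?thesis
    by (simp add: coin_space_def)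
qed

lemma emeasure_coin_uminus:
  "emeasure (measure_pmf (pmf_of_set {- 1, 1 :: real})) (uminus -` A)
    = emeasure (measure_pmf (pmf_of_set {- 1, 1})) A"
proof -
  have "map_pmf uminus (pmf_of_set {- 1, 1 :: real}) = pmf_of_set (uminus ` {- 1, 1})"
    by (rule map_pmf_of_set_inj) auto
  also have "uminus ` {- 1, 1 :: real} = {- 1, 1}"
    by auto
  finally show ?thesis
    by (metis emeasure_map_pmf)
qed

text \<open>By uniqueness of the product measure it suffices to compare cylinders. The flip replaces
  the factor \<open>A m\<close> by its reflection, and a fair sign is symmetric.\<close>

lemma distr_flip_coord: "distr coin_space coin_space (flip_coord m) = coin_space"
proof -
  let ?M = "\<lambda>_::nat. measure_pmf (pmf_of_set {- 1, 1 :: real})"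
  interpret product_prob_space ?M UNIV
    by unfold_locales
  have "coin_space = distr coin_space coin_space (flip_coord m)"
  proof (rule measure_eqI_PiM_infinite[where I = UNIV and M = ?M])
    fix A and J :: "nat set"
    assume J: "finite J" "J \<subseteq> UNIV" and A: "\<And>i. i \<in> J \<Longrightarrow> A i \<in> sets (?M i)"
    let ?A = "A(m := uminus -` A m)"
    have emb: "prod_emb UNIV ?M J (Pi\<^sub>E J B) = {a. \<forall>i\<in>J. a i \<in> B i}" for B
      by (auto simp: prod_emb_def PiE_iff)
    have meas: "{a. \<forall>i\<in>J. a i \<in> B i} \<in> sets coin_space" for B
      unfolding coin_space_def emb[symmetric] by (rule sets_PiM_I) (use J in auto)
    have vim: "flip_coord m -` {a. \<forall>i\<in>J. a i \<in> A i} = {a. \<forall>i\<in>J. a i \<in> ?A i}"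
      by (auto simp: flip_coord_def)
    have "emeasure (distr coin_space coin_space (flip_coord m)) (prod_emb UNIV ?M J (Pi\<^sub>E J A))
        = emeasure coin_space {a. \<forall>i\<in>J. a i \<in> ?A i}"
      unfolding emb vim[symmetric]
      using emeasure_distr[OF measurable_flip_coord meas[of A], of m] by simp
    also have "\<dots> = (\<Prod>i\<in>J. emeasure (?M i) (?A i))"
      unfolding emb[symmetric] coin_space_def using J by (intro emeasure_PiM_emb) auto
    also have "\<dots> = (\<Prod>i\<in>J. emeasure (?M i) (A i))"
      by (intro prod.cong refl) (auto simp: emeasure_coin_uminus)
    also have "\<dots> = emeasure coin_space (prod_emb UNIV ?M J (Pi\<^sub>E J A))"
      unfolding coin_space_def using J by (intro emeasure_PiM_emb[symmetric]) auto
    finally show "emeasure coin_space (prod_emb UNIV ?M J (Pi\<^sub>E J A))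
        = emeasure (distr coin_space coin_space (flip_coord m)) (prod_emb UNIV ?M J (Pi\<^sub>E J A))" ..
  next
    show "finite_measure coin_space"
      using prob_space_coin_space by (rule prob_space.finite_measure)
  qed (auto simp: coin_space_def)
  then show ?thesis ..
qed

section \<open>The random power series and its derivative\<close>

text \<open>An almost sure set on which all the power series converge for parameters in (0,1).
  Outside it \<open>suminf\<close> may be a mere default value, so pointwise estimates are
  restricted to it.\<close>

definition sign_seqs :: "(nat \<Rightarrow> real) set" where
  "sign_seqs = {a. \<forall>m. a m \<in> {- 1, 1}}"

text \<open>\<open>diffs a m\<close> is \<open>(m + 1) * a (m + 1)\<close>: the sign
  \<open>a 0\<close> drops out, which is why flips are made at \<open>Suc m\<close>.\<close>

definition bernoulli_series_deriv :: "real \<Rightarrow> (nat \<Rightarrow> real) \<Rightarrow> real" where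
  "bernoulli_series_deriv l a = (\<Sum>m. diffs a m * l ^ m)"

lemma bernoulli_series_deriv_measurable [measurable]:
  "bernoulli_series_deriv l \<in> borel_measurable coin_space"
  unfolding bernoulli_series_deriv_def diffs_def by measurable

lemma sign_seqs_sets [measurable]: "sign_seqs \<in> sets coin_space"
proof -
  have "{a \<in> space coin_space. \<forall>m. a m = - 1 \<or> a m = 1} \<in> sets coin_space"
    by measurable
  then show ?thesis
    by (simp add: sign_seqs_def)
qed

lemma AE_sign_seqs: "AE a in coin_space. a \<in> sign_seqs"
  using AE_coin_space by (simp add: sign_seqs_def)

lemma sign_seqs_abs: "a \<in> sign_seqs \<Longrightarrow> \<bar>a m\<bar> = 1"
  by (auto simp: sign_seqs_def dest!: spec[of _ m])

text \<open>Termwise differentiation needs convergence on a larger disc; the midpoint of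
  \<open>K\<close> and 1 leaves the room. The hypothesis has the shape of the conclusion for all
  radii, so the lemma can be applied twice.\<close>

lemma summable_diffs_geometric:
  fixes c :: "nat \<Rightarrow> real"
  assumes "\<And>K. 0 < K \<Longrightarrow> K < 1 \<Longrightarrow> summable (\<lambda>n. c n * K ^ n)" "0 < K" "K < 1"
  shows "summable (\<lambda>n. diffs c n * K ^ n)"
proof (rule termdiff_converges[where K = "(K + 1) / 2"])
  show "summable (\<lambda>n. c n * x ^ n)" if "norm x < (K + 1) / 2" for x
    using powser_inside[OF assms(1)[of "(K + 1) / 2"], of x] that assms(2,3) by simp
qed (use assms in auto)

lemma summable_sign_seqs:
  assumes "a \<in> sign_seqs" "0 < K" "K < 1"
  shows "summable (\<lambda>n. a n * K ^ n)"
    and "summable (\<lambda>n. diffs a n * K ^ n)"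
    and "summable (\<lambda>n. diffs (diffs a) n * K ^ n)"
proof -
  have 1: "summable (\<lambda>n. a n * K ^ n)" if "0 < K" "K < 1" for K
  proof (rule summable_comparison_test')
    show "summable (\<lambda>m. K ^ m)"
      using that by (intro summable_geometric) auto
    show "norm (a m * K ^ m) \<le> K ^ m" for m
      using sign_seqs_abs[OF assms(1)] that by (auto simp: abs_mult)
  qed
  have 2: "summable (\<lambda>n. diffs a n * K ^ n)" if "0 < K" "K < 1" for K
    by (rule summable_diffs_geometric) (use 1 that in auto)
  have 3: "summable (\<lambda>n. diffs (diffs a) n * K ^ n)" if "0 < K" "K < 1" for K
    by (rule summable_diffs_geometric) (use 2 that in auto)
  show "summable (\<lambda>n. a n * K ^ n)" "summable (\<lambda>n. diffs a n * K ^ n)"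
    "summable (\<lambda>n. diffs (diffs a) n * K ^ n)"
    using 1 2 3 assms by auto
qed

section \<open>Small values of the derivative\<close>

lemma bernoulli_series_deriv_flip:
  assumes "a \<in> sign_seqs" "0 < l" "l < 1"
  shows "bernoulli_series_deriv l (flip_coord (Suc m) a)
    = bernoulli_series_deriv l a - 2 * a (Suc m) * (real (Suc m) * l ^ m)"
proof -
  have "(\<lambda>n. diffs a n * l ^ n) sums bernoulli_series_deriv l a"
    unfolding bernoulli_series_deriv_def using summable_sign_seqs(2)[OF assms] by (rule summable_sums)
  moreover have "(\<lambda>n. if n = m then 2 * a (Suc m) * (real (Suc m) * l ^ m) else 0)
      sums (2 * a (Suc m) * (real (Suc m) * l ^ m))"
    by (rule sums_single)
  ultimately have "(\<lambda>n. diffs a n * l ^ n - (if n = m then 2 * a (Suc m) * (real (Suc m) * l ^ m) else 0))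
     sums (bernoulli_series_deriv l a - 2 * a (Suc m) * (real (Suc m) * l ^ m))"
    by (rule sums_diff)
  also have "(\<lambda>n. diffs a n * l ^ n - (if n = m then 2 * a (Suc m) * (real (Suc m) * l ^ m) else 0))
     = (\<lambda>n. diffs (flip_coord (Suc m) a) n * l ^ n)"
    by (auto simp: diffs_def flip_coord_def fun_eq_iff)
  finally show ?thesis
    unfolding bernoulli_series_deriv_def by (simp add: sums_iff)
qed

text \<open>Consecutive coefficients of Y differ by l^j ((j+1) - (j+2) l), and j \<ge>
  \<open>m0\<close> makes the bracket at least 1. A flip changes Y by twice a coefficient, so the
  margin l^k becomes 2 l^k, enough to separate two open intervals of radius l^k.\<close>

lemma deriv_coeff_gap:
  assumes l: "0 < l" "l < 1" and m0: "2 \<le> real m0 * (1 - l)" and "m0 \<le> i" "i < j" "j \<le> k"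
  shows "real (Suc j) * l ^ j + l ^ k \<le> real (Suc i) * l ^ i"
  using \<open>i < j\<close> \<open>j \<le> k\<close>
proof (induction j)
  case 0
  then show ?case by simp
next
  case (Suc j)
  have "m0 \<le> j"
    using assms(4) Suc.prems by linarith
  then have "real m0 * (1 - l) \<le> real j * (1 - l)"
    using l by (intro mult_right_mono) auto
  then have "1 \<le> real (Suc j) - real (Suc (Suc j)) * l"
    using m0 l by (simp add: algebra_simps)
  then have "l ^ j * 1 \<le> l ^ j * (real (Suc j) - real (Suc (Suc j)) * l)"
    using l by (intro mult_left_mono) auto
  moreover have "l ^ k \<le> l ^ j"
    using l Suc.prems by (intro power_decreasing) auto
  ultimately have step: "real (Suc (Suc j)) * l ^ Suc j + l ^ k \<le> real (Suc j) * l ^ j"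
    by (simp add: algebra_simps)
  show ?case
  proof (cases "i = j")
    case True
    then show ?thesis using step by simp
  next
    case False
    then have "real (Suc j) * l ^ j + l ^ k \<le> real (Suc i) * l ^ i"
      using Suc by simp
    moreover have "0 \<le> l ^ k"
      using l by simp
    ultimately show ?thesis
      using step by linarith
  qed
qed

text \<open>
  Flipping the sign number \<open>m + 1\<close> moves the event $|Y| < \lambda^k$ to an event of equal probability
  on which $|Y|$ is within $\lambda^k$ of $2 (m+1) \lambda^m$. For large \<open>m \<le> k\<close> these values are
  so far apart that the moved events are disjoint.
\<close>

lemma prob_deriv_small_power:
  assumes l: "0 < l" "l < 1" and m0: "2 \<le> real m0 * (1 - l)"
  shows "measure coin_space {a. \<bar>bernoulli_series_deriv l a\<bar> < l ^ k} * (real k - real m0) \<le> 1"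
proof (cases "m0 \<le> k")
  case True
  interpret prob_space coin_space by (rule prob_space_coin_space)
  let ?Y = "bernoulli_series_deriv l"
  define E where "E = {a \<in> sign_seqs. \<bar>?Y a\<bar> < l ^ k}"
  have E_sets [measurable]: "E \<in> sets coin_space"
  proof -
    have "{a \<in> space coin_space. a \<in> sign_seqs \<and> \<bar>?Y a\<bar> < l ^ k} \<in> sets coin_space"
      by measurable
    then show ?thesis by (simp add: E_def)
  qed
  have "measure coin_space {a. \<bar>?Y a\<bar> < l ^ k} = measure coin_space E"
  proof (rule finite_measure_eq_AE)
    show "AE a in coin_space. (a \<in> {a. \<bar>?Y a\<bar> < l ^ k}) = (a \<in> E)"
      using AE_sign_seqs by eventually_elim (simp add: E_def)
    have "{a \<in> space coin_space. \<bar>?Y a\<bar> < l ^ k} \<in> sets coin_space"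
      by measurable
    then show "{a. \<bar>?Y a\<bar> < l ^ k} \<in> sets coin_space" by simp
  qed simp
  moreover have "measure coin_space E * (real k - real m0) \<le> 1"
  proof -
    define F where "F m = flip_coord (Suc m) -` E" for m
    have F_sets: "F m \<in> sets coin_space" for m
      using measurable_sets[OF measurable_flip_coord E_sets, of "Suc m"] by (simp add: F_def)
    have F_meas: "measure coin_space (F m) = measure coin_space E" for m
      using measure_distr[OF measurable_flip_coord E_sets, of "Suc m"]
      by (simp add: F_def distr_flip_coord)
    have F_val: "a \<in> sign_seqs \<and> \<bar>\<bar>?Y a\<bar> - 2 * (real (Suc m) * l ^ m)\<bar> < l ^ k" if "a \<in> F m" for a m
    proof -
      have b: "flip_coord (Suc m) a \<in> sign_seqs" "\<bar>?Y (flip_coord (Suc m) a)\<bar> < l ^ k"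
        using that by (auto simp: F_def E_def)
      have a: "a \<in> sign_seqs"
      proof -
        have "a i \<in> {- 1, 1}" for i
          using b(1) unfolding sign_seqs_def flip_coord_def
          by (cases "i = Suc m") (auto dest!: spec[of _ i])
        then show ?thesis by (auto simp: sign_seqs_def)
      qed
      have "a (Suc m) = 1 \<or> a (Suc m) = - 1"
        using a by (auto simp: sign_seqs_def)
      moreover have "0 \<le> real (Suc m) * l ^ m"
        using l by simp
      ultimately show ?thesis
        using b(2) a unfolding bernoulli_series_deriv_flip[OF a l] by auto
    qed
    have "disjoint_family_on F {m0..<k}"
    proof -
      have "F i \<inter> F j = {}" if "i \<in> {m0..<k}" "j \<in> {m0..<k}" "i < j" for i j
      proof -
        have "real (Suc j) * l ^ j + l ^ k \<le> real (Suc i) * l ^ i"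
          using deriv_coeff_gap[OF l m0, of i j k] that by simp
        then show ?thesis
          using F_val[of _ i] F_val[of _ j] by fastforce
      qed
      then show ?thesis
        unfolding disjoint_family_on_def by (metis inf_commute linorder_neqE_nat)
    qed
    then have "measure coin_space (\<Union>m\<in>{m0..<k}. F m) = (\<Sum>m\<in>{m0..<k}. measure coin_space (F m))"
      using F_sets by (intro finite_measure_finite_Union) auto
    also have "\<dots> = measure coin_space E * (real k - real m0)"
      using True by (simp add: F_meas of_nat_diff)
    finally show ?thesis
      using prob_le_1[of "\<Union>m\<in>{m0..<k}. F m"] by simp
  qed
  ultimately show ?thesis by simp
next
  case False
  then have "measure coin_space {a. \<bar>bernoulli_series_deriv l a\<bar> < l ^ k} * (real k - real m0) \<le> 0"
    by (intro mult_nonneg_nonpos) auto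
  then show ?thesis by linarith
qed

lemma prob_deriv_small:
  assumes l: "0 < l" "l < 1"
  obtains K where "K > 0"
    "\<And>T. T > 0 \<Longrightarrow> measure coin_space {a. \<bar>bernoulli_series_deriv l a\<bar> < exp (- T)} \<le> K / T"
proof -
  interpret prob_space coin_space by (rule prob_space_coin_space)
  let ?P = "\<lambda>t. measure coin_space {a. \<bar>bernoulli_series_deriv l a\<bar> < t}"
  define m0 where "m0 = nat \<lceil>2 / (1 - l)\<rceil>"
  have "2 / (1 - l) \<le> real m0"
    unfolding m0_def by (rule real_nat_ceiling_ge)
  then have m0: "2 \<le> real m0 * (1 - l)"
    using l by (simp add: field_simps)
  define L where "L = - ln l"
  have L: "L > 0"
    using l by (simp add: L_def)
  \<comment> \<open>For T < K the claim is trivial because K / T > 1. For T \<ge> K the loss 1 +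
    \<open>m0\<close>, from rounding and from the excluded indices, is at most half of T /
    L.\<close>
  define K where "K = 2 * L * (1 + real m0)"
  have "K > 0"
    using L by (simp add: K_def)
  moreover have "?P (exp (- T)) \<le> K / T" if T: "T > 0" for T
  proof (cases "K \<le> T")
    case False
    then have "1 \<le> K / T"
      using T by (simp add: field_simps)
    then show ?thesis
      using prob_le_1 order.trans by blast
  next
    case True
    \<comment> \<open>The largest exponent with l^k \<ge> exp(-T).\<close>
    define k where "k = nat \<lfloor>T / L\<rfloor>"
    have k: "real k \<le> T / L" "T / L - 1 \<le> real k"
      using T L unfolding k_def by (auto simp: of_nat_nat)
    have lk: "l ^ k = exp (- (L * real k))"
      using l by (simp add: L_def exp_of_nat_mult[symmetric] mult.commute exp_minus powr_realpow[symmetric] powr_def)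
    have "exp (- T) \<le> l ^ k"
      unfolding lk using k L by (simp add: field_simps)
    then have "?P (exp (- T)) \<le> ?P (l ^ k)"
    proof (intro finite_measure_mono)
      have "{a \<in> space coin_space. \<bar>bernoulli_series_deriv l a\<bar> < l ^ k} \<in> sets coin_space"
        by measurable
      then show "{a. \<bar>bernoulli_series_deriv l a\<bar> < l ^ k} \<in> sets coin_space" by simp
    qed auto
    moreover have "1 + real m0 \<le> T / (2 * L)"
      using True L by (simp add: K_def field_simps)
    then have k2: "T / (2 * L) \<le> real k - real m0"
      using k(2) by simp
    then have "?P (l ^ k) * (T / (2 * L)) \<le> ?P (l ^ k) * (real k - real m0)"
      by (intro mult_left_mono) auto
    then have "?P (l ^ k) * (T / (2 * L)) \<le> 1"
      using prob_deriv_small_power[OF l m0, of k] by linarith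
    then have "?P (l ^ k) \<le> 2 * L / T"
      using L T by (simp add: field_simps)
    moreover have "2 * L / T \<le> K / T"
      using L T by (intro divide_right_mono) (auto simp: K_def)
    ultimately show ?thesis by linarith
  qed
  ultimately show ?thesis
    using that by blast
qed

section \<open>Taylor bounds uniform in the sign sequence\<close>

lemma abs_powser_le:
  fixes a c :: "nat \<Rightarrow> real"
  assumes "summable (\<lambda>n. c n * K ^ n)" "\<And>n. \<bar>a n\<bar> = c n" "0 \<le> x" "x \<le> K"
  shows "\<bar>\<Sum>n. a n * x ^ n\<bar> \<le> (\<Sum>n. c n * K ^ n)"
proof -
  have le: "\<bar>a n * x ^ n\<bar> \<le> c n * K ^ n" for n
    using assms(2)[of n] assms(3,4) by (auto simp: abs_mult intro!: mult_mono power_mono)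
  have sa: "summable (\<lambda>n. \<bar>a n * x ^ n\<bar>)"
    by (rule summable_comparison_test'[OF assms(1)]) (use le in auto)
  have "\<bar>\<Sum>n. a n * x ^ n\<bar> \<le> (\<Sum>n. \<bar>a n * x ^ n\<bar>)"
    using sa by (rule summable_rabs)
  also have "\<dots> \<le> (\<Sum>n. c n * K ^ n)"
    using le sa assms(1) by (rule suminf_le)
  finally show ?thesis .
qed

text \<open>The second bound compares the increment between any two parameters with the speed at the
  single point l. Hence one random variable Y governs the spacing of all sampled points, with a
  relative error controlled by y - l.\<close>

lemma bernoulli_series_taylor:
  assumes l: "0 < l" "l < 1"
  obtains B where "B > 0"
    "\<And>a x y. a \<in> sign_seqs \<Longrightarrow> l \<le> x \<Longrightarrow> x < y \<Longrightarrow> y \<le> (1 + l) / 2 \<Longrightarrow>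
       \<bar>bernoulli_series y a - bernoulli_series x a\<bar> \<le> B * (y - x)"
    "\<And>a x y. a \<in> sign_seqs \<Longrightarrow> l \<le> x \<Longrightarrow> x < y \<Longrightarrow> y \<le> (1 + l) / 2 \<Longrightarrow>
       \<bar>bernoulli_series y a - bernoulli_series x a - (y - x) * bernoulli_series_deriv l a\<bar>
         \<le> B * (y - l) * (y - x)"
proof -
  define K where "K = (1 + l) / 2"
  have K: "0 < K" "K < 1" "l < K"
    using l by (auto simp: K_def)
  \<comment> \<open>Termwise differentiation at \<open>K\<close> itself requires convergence at a
    strictly larger radius.\<close>
  define K' where "K' = (1 + K) / 2"
  have K': "0 < K'" "K' < 1" "K < K'"
    using K by (auto simp: K'_def)
  \<comment> \<open>The constant sequence 1 dominates the coefficients of every sign sequence, also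
    after \<open>diffs\<close>; this makes \<open>B\<close> independent of the sequence.\<close>
  define u where "u = (\<lambda>_::nat. 1 :: real)"
  have u: "u \<in> sign_seqs"
    by (simp add: u_def sign_seqs_def)
  define B where "B = (\<Sum>n. diffs u n * K ^ n) + (\<Sum>n. diffs (diffs u) n * K ^ n) + 1"
  define f1 where "f1 a x = (\<Sum>n. diffs a n * x ^ n)" for a :: "nat \<Rightarrow> real" and x
  define f2 where "f2 a x = (\<Sum>n. diffs (diffs a) n * x ^ n)" for a :: "nat \<Rightarrow> real" and x
  have "0 \<le> (\<Sum>n. diffs u n * K ^ n)"
    by (rule suminf_nonneg[OF summable_sign_seqs(2)[OF u K(1,2)]]) (use K in \<open>simp add: diffs_def u_def\<close>)
  moreover have "0 \<le> (\<Sum>n. diffs (diffs u) n * K ^ n)"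
    by (rule suminf_nonneg[OF summable_sign_seqs(3)[OF u K(1,2)]]) (use K in \<open>simp add: diffs_def u_def\<close>)
  ultimately have nonneg: "0 \<le> (\<Sum>n. diffs u n * K ^ n)" "0 \<le> (\<Sum>n. diffs (diffs u) n * K ^ n)"
    by auto
  have f1: "\<bar>f1 a x\<bar> \<le> B" if "a \<in> sign_seqs" "0 \<le> x" "x \<le> K" for a x
  proof -
    have "\<bar>f1 a x\<bar> \<le> (\<Sum>n. diffs u n * K ^ n)"
      unfolding f1_def
      by (rule abs_powser_le[OF summable_sign_seqs(2)[OF u K(1,2)]])
        (use that in \<open>auto simp: diffs_def u_def abs_mult sign_seqs_abs\<close>)
    then show ?thesis using nonneg by (simp add: B_def)
  qed
  have f2: "\<bar>f2 a x\<bar> \<le> B" if "a \<in> sign_seqs" "0 \<le> x" "x \<le> K" for a x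
  proof -
    have "\<bar>f2 a x\<bar> \<le> (\<Sum>n. diffs (diffs u) n * K ^ n)"
      unfolding f2_def
      by (rule abs_powser_le[OF summable_sign_seqs(3)[OF u K(1,2)]])
        (use that in \<open>auto simp: diffs_def u_def abs_mult sign_seqs_abs\<close>)
    then show ?thesis using nonneg by (simp add: B_def)
  qed
  have D1: "DERIV (\<lambda>x. bernoulli_series x a) x :> f1 a x" if "a \<in> sign_seqs" "0 \<le> x" "x \<le> K" for a x
    unfolding bernoulli_series_def f1_def
    by (rule termdiffs_strong[where K = K']) (use that K' in \<open>auto intro: summable_sign_seqs\<close>)
  have D2: "DERIV (f1 a) x :> f2 a x" if "a \<in> sign_seqs" "0 \<le> x" "x \<le> K" for a x
    unfolding f1_def f2_def
    by (rule termdiffs_strong[where K = K']) (use that K' in \<open>auto intro: summable_sign_seqs\<close>)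
  have main: "\<bar>bernoulli_series y a - bernoulli_series x a\<bar> \<le> B * (y - x) \<and>
       \<bar>bernoulli_series y a - bernoulli_series x a - (y - x) * bernoulli_series_deriv l a\<bar>
         \<le> B * (y - l) * (y - x)"
    if a: "a \<in> sign_seqs" and xy: "l \<le> x" "x < y" "y \<le> (1 + l) / 2" for a x y
  proof -
    obtain z where z: "x < z" "z < y" "bernoulli_series y a - bernoulli_series x a = (y - x) * f1 a z"
      using MVT2[OF xy(2), of "\<lambda>x. bernoulli_series x a" "f1 a"] D1[OF a] xy l K_def by fastforce
    obtain w where w: "l < w" "w < z" "f1 a z - f1 a l = (z - l) * f2 a w"
      using MVT2[of l z "f1 a" "f2 a"] D2[OF a] xy l z K_def by fastforce
    have d: "bernoulli_series_deriv l a = f1 a l"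
      by (simp add: bernoulli_series_deriv_def f1_def)
    have "\<bar>f1 a z\<bar> \<le> B"
      using f1[OF a, of z] xy z l K_def by simp
    then have "(y - x) * \<bar>f1 a z\<bar> \<le> (y - x) * B"
      using xy by (intro mult_left_mono) auto
    then have 1: "\<bar>bernoulli_series y a - bernoulli_series x a\<bar> \<le> B * (y - x)"
      using xy unfolding z(3) abs_mult by (simp add: mult.commute)
    have "\<bar>f2 a w\<bar> \<le> B"
      using f2[OF a, of w] xy z l K_def w by simp
    then have "(z - l) * \<bar>f2 a w\<bar> \<le> (y - l) * B"
      using xy z by (intro mult_mono) auto
    then have "\<bar>f1 a z - f1 a l\<bar> \<le> (y - l) * B"
      using xy z unfolding w(3) abs_mult by simp
    then have "(y - x) * \<bar>f1 a z - f1 a l\<bar> \<le> (y - x) * ((y - l) * B)"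
      using xy by (intro mult_left_mono) auto
    moreover have "\<bar>bernoulli_series y a - bernoulli_series x a - (y - x) * bernoulli_series_deriv l a\<bar>
        = (y - x) * \<bar>f1 a z - f1 a l\<bar>"
      unfolding z(3) d right_diff_distrib[symmetric] abs_mult using xy by simp
    ultimately show ?thesis
      using 1 by (simp add: algebra_simps)
  qed
  have "B > 0"
    using nonneg by (simp add: B_def)
  then show ?thesis
    using that main by blast
qed

lemma bernoulli_series_abs_le:
  assumes "a \<in> sign_seqs" "0 < l" "l < 1"
  shows "\<bar>bernoulli_series l a\<bar> \<le> 1 / (1 - l)"
proof -
  have "\<bar>bernoulli_series l a\<bar> \<le> (\<Sum>n. 1 * l ^ n)"
    unfolding bernoulli_series_def
    by (rule abs_powser_le) (use assms in \<open>auto simp: sign_seqs_abs intro!: summable_geometric\<close>)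
  then show ?thesis
    using assms by (simp add: suminf_geometric)
qed

section \<open>Hoelder test functions\<close>

text \<open>The required separation grows with the index gap, so comparing the smallest and the
  largest index of \<open>S\<close> is enough.\<close>

lemma card_separated_points_le:
  fixes p :: "nat \<Rightarrow> real"
  assumes "finite S" "g > 0" "u \<le> v"
    and sep: "\<And>i j. i \<in> S \<Longrightarrow> j \<in> S \<Longrightarrow> i < j \<Longrightarrow> g * (real j - real i) \<le> \<bar>p j - p i\<bar>"
    and "p ` S \<subseteq> {u..v}"
  shows "real (card S) \<le> 1 + (v - u) / g"
proof (cases "S = {}")
  case True
  then show ?thesis using assms by simp
next
  case False
  have "S \<subseteq> {Min S..Max S}"
    using assms(1) by auto
  then have "card S \<le> Suc (Max S) - Min S"
    using card_mono[of "{Min S..Max S}" S] by simp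
  moreover have le: "Min S \<le> Max S"
    using False assms(1) by auto
  ultimately have card: "real (card S) \<le> 1 + (real (Max S) - real (Min S))"
    by linarith
  have mem: "Min S \<in> S" "Max S \<in> S"
    using False assms(1) by auto
  have "g * (real (Max S) - real (Min S)) \<le> v - u"
  proof (cases "Min S = Max S")
    case False
    have "p (Min S) \<in> {u..v}" "p (Max S) \<in> {u..v}"
      using mem assms(5) by blast+
    then show ?thesis
      using sep[OF mem] False le by auto
  qed (use assms in simp)
  then have "real (Max S) - real (Min S) \<le> (v - u) / g"
    using assms(2) by (simp add: field_simps)
  then show ?thesis using card by linarith
qed

lemma holder_norm_le:
  assumes "\<And>x. \<bar>\<phi> x\<bar> \<le> b" "\<And>x y. \<bar>\<phi> x - \<phi> y\<bar> \<le> c * \<bar>x - y\<bar> powr \<theta>"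
  shows "\<phi> \<in> holder_space \<theta>" "holder_norm \<theta> \<phi> \<le> b + c"
proof -
  show "\<phi> \<in> holder_space \<theta>"
    using assms unfolding holder_space_def bounded_iff by auto
  have "(SUP x. \<bar>\<phi> x\<bar>) \<le> b"
    using assms(1) by (intro cSUP_least) auto
  moreover have "(SUP (x, y) \<in> {(x, y). x \<noteq> y}. \<bar>\<phi> x - \<phi> y\<bar> / \<bar>x - y\<bar> powr \<theta>) \<le> c"
  proof (rule cSUP_least)
    have "(0 :: real, 1 :: real) \<in> {(x, y). x \<noteq> y}"
      by simp
    then show "{(x :: real, y). x \<noteq> y} \<noteq> {}"
      by blast
  qed (use assms(2) in \<open>auto simp: field_simps\<close>)
  ultimately show "holder_norm \<theta> \<phi> \<le> b + c"
    unfolding holder_norm_def by linarith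
qed

lemma holder_space_continuous:
  assumes "\<phi> \<in> holder_space \<theta>" "\<theta> > 0"
  shows "continuous_on UNIV \<phi>"
proof -
  obtain C where C: "\<And>x y. \<bar>\<phi> x - \<phi> y\<bar> \<le> C * \<bar>x - y\<bar> powr \<theta>"
    using assms(1) unfolding holder_space_def by auto
  have "isCont \<phi> x" for x
    unfolding isCont_def
  proof (rule Lim_null[THEN iffD2], rule Lim_null_comparison)
    show "\<forall>\<^sub>F y in at x. norm (\<phi> y - \<phi> x) \<le> C * \<bar>y - x\<bar> powr \<theta>"
      using C by simp
    have "((\<lambda>y. C * \<bar>y - x\<bar> powr \<theta>) \<longlongrightarrow> C * \<bar>x - x\<bar> powr \<theta>) (at x)"
      using assms(2) by (intro tendsto_intros tendsto_powr2) auto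
    then show "((\<lambda>y. C * \<bar>y - x\<bar> powr \<theta>) \<longlongrightarrow> 0) (at x)"
      by simp
  qed
  then show ?thesis
    by (simp add: continuous_on_eq_continuous_within)
qed

lemma holder_space_measurable:
  "\<phi> \<in> holder_space \<theta> \<Longrightarrow> \<theta> > 0 \<Longrightarrow> \<phi> \<in> borel_measurable borel"
  using holder_space_continuous by (rule borel_measurable_continuous_onI)

lemma holder_space_integrable:
  assumes "\<phi> \<in> holder_space \<theta>" "\<theta> > 0"
  shows "integrable (bernoulli_convolution l) \<phi>"
proof -
  interpret prob_space "bernoulli_convolution l"
    by (rule prob_space_bernoulli_convolution)
  show ?thesis
  proof (rule integrable_const_bound)
    show "AE x in bernoulli_convolution l. norm (\<phi> x) \<le> holder_norm \<theta> \<phi>"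
      using holder_norm_ge[OF assms(1)] by simp
  qed (use holder_space_measurable[OF assms] in \<open>simp add: measurable_cong_sets[OF sets_bernoulli_convolution refl]\<close>)
qed

lemma integral_bernoulli_convolution:
  fixes \<phi> :: "real \<Rightarrow> real"
  assumes "\<phi> \<in> borel_measurable borel"
  shows "(\<integral>x. \<phi> x \<partial>bernoulli_convolution l) = (\<integral>a. \<phi> (bernoulli_series l a) \<partial>coin_space)"
  unfolding bernoulli_convolution_def by (rule integral_distr) (use assms in auto)

lemma measure_bernoulli_convolution:
  assumes "A \<in> sets borel"
  shows "measure (bernoulli_convolution l) A = measure coin_space {a. bernoulli_series l a \<in> A}"
  unfolding bernoulli_convolution_def using assms
  by (subst measure_distr) (auto simp: vimage_def)

section \<open>Tent functions\<close>

definition tent :: "real set \<Rightarrow> real \<Rightarrow> real \<Rightarrow> real" where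
  "tent E r x = max 0 (1 - infdist x E / r)"

lemma tent_bounds: "r > 0 \<Longrightarrow> 0 \<le> tent E r x" "r > 0 \<Longrightarrow> tent E r x \<le> 1"
  by (auto simp: tent_def infdist_nonneg)

lemma tent_eq_1: "x \<in> E \<Longrightarrow> tent E r x = 1"
  by (simp add: tent_def)

lemma tent_support:
  assumes "r > 0" "E \<noteq> {}" "tent E r x \<noteq> 0"
  obtains e where "e \<in> E" "dist x e < r"
proof -
  have "infdist x E < r"
    using assms by (auto simp: tent_def max_def field_simps split: if_splits)
  then have "(INF e\<in>E. dist x e) < r"
    using assms(2) by (simp add: infdist_notempty)
  then show ?thesis
    using that assms(2) by (subst (asm) cINF_less_iff) (auto intro: bdd_belowI2[where m = 0])
qed

text \<open>With q = |x - y| / r the difference is at most q, by the Lipschitz bound, and at most 1;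
  and min q 1 \<le> q^\<theta> for exponents between 0 and 1.\<close>

lemma tent_holder:
  assumes "0 < r" "0 < \<theta>" "\<theta> < 1"
  shows "\<bar>tent E r x - tent E r y\<bar> \<le> r powr - \<theta> * \<bar>x - y\<bar> powr \<theta>"
proof -
  define q where "q = \<bar>x - y\<bar> / r"
  have q: "0 \<le> q"
    using assms by (simp add: q_def)
  have "\<bar>infdist x E - infdist y E\<bar> \<le> \<bar>x - y\<bar>"
    using infdist_triangle_abs[of x E y] by (simp add: dist_real_def)
  then have "\<bar>infdist x E / r - infdist y E / r\<bar> \<le> q"
    using assms by (simp add: q_def diff_divide_distrib[symmetric] abs_divide divide_right_mono)
  then have "\<bar>tent E r x - tent E r y\<bar> \<le> q"
    by (auto simp: tent_def)
  moreover have "\<bar>tent E r x - tent E r y\<bar> \<le> 1"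
    using tent_bounds[OF assms(1), of E x] tent_bounds[OF assms(1), of E y] by auto
  moreover have "min q 1 \<le> q powr \<theta>"
  proof (cases "q \<le> 1")
    case True
    then have "q powr 1 \<le> q powr \<theta>"
      using q assms by (intro powr_mono') auto
    then show ?thesis using q True by simp
  next
    case False
    then show ?thesis using assms by (simp add: ge_one_powr_ge_zero)
  qed
  moreover have "q powr \<theta> = r powr - \<theta> * \<bar>x - y\<bar> powr \<theta>"
    using assms by (simp add: q_def powr_divide powr_minus field_simps)
  ultimately show ?thesis by linarith
qed

section \<open>Decay of the measure between two scales\<close>

definition grid_cell :: "real \<Rightarrow> int \<Rightarrow> real set" where
  "grid_cell r k = {of_int k * r..<of_int (k + 1) * r}"

lemma mem_grid_cell_iff: "r > 0 \<Longrightarrow> x \<in> grid_cell r k \<longleftrightarrow> k = \<lfloor>x / r\<rfloor>"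
  unfolding eq_commute[of k] floor_eq_iff
  by (simp add: grid_cell_def pos_le_divide_eq pos_divide_less_eq)

lemma grid_cell_sets [measurable, simp]: "grid_cell r k \<in> sets borel"
  by (simp add: grid_cell_def)

text \<open>The shift \<open>d\<close> serves the sums over left and right neighbours of the cells
  in \<open>S\<close>. This is also why the next lemma writes the neighbours as
  \<open>k + (-1)\<close>, \<open>k + 0\<close> and \<open>k + 1\<close>.\<close>

lemma sum_measure_grid_cells_le_1:
  fixes d :: int
  assumes "prob_space M" "sets M = sets borel" "r > 0" "finite S"
  shows "(\<Sum>k\<in>S. measure M (grid_cell r (k + d))) \<le> 1"
proof -
  interpret prob_space M by fact
  have "disjoint_family_on (\<lambda>k. grid_cell r (k + d)) S"
    using assms(3) by (auto simp: disjoint_family_on_def mem_grid_cell_iff)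
  then have "measure M (\<Union>k\<in>S. grid_cell r (k + d)) = (\<Sum>k\<in>S. measure M (grid_cell r (k + d)))"
    using assms(4) by (intro finite_measure_finite_Union) (auto simp: assms(2))
  then show ?thesis
    using prob_le_1[of "\<Union>k\<in>S. grid_cell r (k + d)"] by simp
qed

lemma measure_cball_le_grid_cells:
  fixes x :: real
  assumes "prob_space M" "sets M = sets borel" "x \<in> grid_cell r k"
  shows "measure M (cball x r) \<le> measure M (grid_cell r (k + (-1))) + measure M (grid_cell r (k + 0))
    + measure M (grid_cell r (k + 1))"
proof -
  interpret prob_space M by fact
  have "cball x r \<subseteq> grid_cell r (k + (-1)) \<union> grid_cell r (k + 0) \<union> grid_cell r (k + 1)"
    using assms(3) by (auto simp: grid_cell_def cball_def dist_real_def algebra_simps abs_le_iff)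
  then have "measure M (cball x r) \<le> measure M (grid_cell r (k + (-1)) \<union> grid_cell r (k + 0) \<union> grid_cell r (k + 1))"
    using assms(2) by (intro finite_measure_mono) auto
  also have "\<dots> \<le> measure M (grid_cell r (k + (-1)) \<union> grid_cell r (k + 0)) + measure M (grid_cell r (k + 1))"
    using assms(2) by (intro measure_Un_le) auto
  also have "measure M (grid_cell r (k + (-1)) \<union> grid_cell r (k + 0)) \<le> measure M (grid_cell r (k + (-1))) + measure M (grid_cell r (k + 0))"
    using assms(2) by (intro measure_Un_le) auto
  finally show ?thesis by simp
qed

text \<open>
  The union \<open>E\<close> of the \<open>r\<close>-cells meeting the bad set is tested with the tent function over \<open>E\<close>, and the
  integral is compared with its average over the \<open>N\<close> parameters $l + \epsilon j / N$. If $|Y| \ge \tau$, the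
  points $X(l + \epsilon j / N)$ are separated by $\tau\epsilon / (2N)$, so few of them lie near one
  cell, and they do so only if $X(l)$ is within \<open>\<rho>\<close> of it; badness bounds the probability of the latter.
\<close>

lemma bad_scale_set_bound:
  fixes l \<theta> C e0 B W r \<rho> \<epsilon> \<tau> M :: real and N :: nat
  assumes l: "0 < l" "l < 1" and \<theta>: "0 < \<theta>" "\<theta> < 1"
    and H: "\<And>x \<phi>. l < x \<Longrightarrow> x < l + e0 \<Longrightarrow> \<phi> \<in> holder_space \<theta> \<Longrightarrow>
      \<bar>(\<integral>y. \<phi> y \<partial>bernoulli_convolution x) - (\<integral>y. \<phi> y \<partial>bernoulli_convolution l)\<bar>
        \<le> C * (x - l) * holder_norm \<theta> \<phi>" and C: "C \<ge> 0"
    and B: "B > 0"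
      "\<And>a x y. a \<in> sign_seqs \<Longrightarrow> l \<le> x \<Longrightarrow> x < y \<Longrightarrow> y \<le> (1 + l) / 2 \<Longrightarrow>
       \<bar>bernoulli_series y a - bernoulli_series x a\<bar> \<le> B * (y - x)"
      "\<And>a x y. a \<in> sign_seqs \<Longrightarrow> l \<le> x \<Longrightarrow> x < y \<Longrightarrow> y \<le> (1 + l) / 2 \<Longrightarrow>
       \<bar>bernoulli_series y a - bernoulli_series x a - (y - x) * bernoulli_series_deriv l a\<bar>
         \<le> B * (y - l) * (y - x)"
    and r: "0 < r" "r < 1" and \<epsilon>: "0 < \<epsilon>" "\<epsilon> < e0" "l + \<epsilon> \<le> (1 + l) / 2"
    and \<tau>: "0 < \<tau>" "2 * B * \<epsilon> \<le> \<tau>" and \<rho>: "0 < \<rho>" "2 * r + B * \<epsilon> \<le> \<rho>" and M: "M > 0" and N: "N > 0"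
  obtains E where "E \<in> sets borel"
    "\<And>x. \<bar>x\<bar> \<le> W \<Longrightarrow> M * (r / \<rho>) * measure (bernoulli_convolution l) (cball x \<rho>)
        < measure (bernoulli_convolution l) (cball x r) \<Longrightarrow> x \<in> E"
    "measure (bernoulli_convolution l) E \<le>
       measure coin_space {a. \<bar>bernoulli_series_deriv l a\<bar> < \<tau>}
       + (1 / real N + 6 * r / (\<tau> * \<epsilon>)) * (3 * \<rho> / (M * r)) + 2 * C * \<epsilon> * r powr - \<theta>"
proof -
  let ?\<mu> = "bernoulli_convolution l"
  let ?X = bernoulli_series
  let ?Y = "bernoulli_series_deriv l"
  interpret prob_space coin_space by (rule prob_space_coin_space)
  interpret \<mu>: prob_space ?\<mu> by (rule prob_space_bernoulli_convolution)
  define F where "F = {x. \<bar>x\<bar> \<le> W \<and> M * (r / \<rho>) * measure ?\<mu> (cball x \<rho>) < measure ?\<mu> (cball x r)}"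
  \<comment> \<open>Enlarging the bad set to full cells makes measurability immediate; the bound
    \<open>W\<close> keeps the number of cells finite.\<close>
  define S where "S = (\<lambda>x. \<lfloor>x / r\<rfloor>) ` F"
  define E where "E = (\<Union>k\<in>S. grid_cell r k)"
  have "finite S"
  proof (rule finite_subset)
    show "S \<subseteq> {\<lfloor>- W / r\<rfloor>..\<lfloor>W / r\<rfloor>}"
    proof
      fix k assume "k \<in> S"
      then obtain x where x: "k = \<lfloor>x / r\<rfloor>" "- W \<le> x" "x \<le> W"
        by (auto simp: S_def F_def abs_le_iff)
      have "- W / r \<le> x / r" "x / r \<le> W / r"
        using r x by (intro divide_right_mono; simp)+
      then show "k \<in> {\<lfloor>- W / r\<rfloor>..\<lfloor>W / r\<rfloor>}"
        using x(1) by (simp add: floor_mono)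
    qed
  qed simp
  have E_sets [measurable]: "E \<in> sets borel"
    unfolding E_def using \<open>finite S\<close> by (intro sets.finite_UN) auto
  have FE: "F \<subseteq> E"
    using r by (auto simp: E_def S_def mem_grid_cell_iff)
  have "\<forall>k\<in>S. \<exists>x. x \<in> F \<and> x \<in> grid_cell r k"
    using r by (auto simp: S_def mem_grid_cell_iff)
  then obtain p where p: "\<And>k. k \<in> S \<Longrightarrow> p k \<in> F \<and> p k \<in> grid_cell r k"
    by metis
  let ?P = "measure coin_space {a. \<bar>?Y a\<bar> < \<tau>}"
  \<comment> \<open>Relevant points are \<tau>\<epsilon>/(2N) apart, so at most 1 + 3r /
    (\<tau>\<epsilon>/(2N)) of them fit into an interval of length 3r.\<close>
  let ?c = "1 + 6 * r * real N / (\<tau> * \<epsilon>)"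
  have c: "?c \<ge> 0"
    using r \<tau> \<epsilon> by simp
  have "measure ?\<mu> E \<le> ?P + (1 / real N + 6 * r / (\<tau> * \<epsilon>)) * (3 * \<rho> / (M * r)) + 2 * C * \<epsilon> * r powr - \<theta>"
  proof (cases "S = {}")
    case True
    \<comment> \<open>This case is separate because \<open>infdist x {} = 0\<close> would make the
      tent function over the empty set constantly 1.\<close>
    then have "E = {}" by (simp add: E_def)
    then show ?thesis
      using r \<tau> \<epsilon> \<rho> M C by (auto intro!: add_nonneg_nonneg mult_nonneg_nonneg)
  next
    case False
    then have "E \<noteq> {}"
      using p by (force simp: E_def)
    define \<phi> where "\<phi> = tent E r"
    have \<phi>_bounds: "0 \<le> \<phi> x" "\<phi> x \<le> 1" for x
      using tent_bounds[OF r(1)] by (auto simp: \<phi>_def)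
    have \<phi>_holder: "\<phi> \<in> holder_space \<theta>" and \<phi>_norm: "holder_norm \<theta> \<phi> \<le> 1 + r powr - \<theta>"
      using holder_norm_le[where \<phi> = \<phi> and b = 1 and c = "r powr - \<theta>" and \<theta> = \<theta>]
        \<phi>_bounds tent_holder[OF r(1) \<theta>] by (auto simp: \<phi>_def)
    have \<phi>_meas [measurable]: "\<phi> \<in> borel_measurable borel"
      using holder_space_measurable[OF \<phi>_holder] \<theta> by simp
    have "1 \<le> r powr - \<theta>"
      using r \<theta> powr_mono'[of "- \<theta>" 0 r] by simp
    then have \<phi>_norm': "holder_norm \<theta> \<phi> \<le> 2 * r powr - \<theta>"
      using \<phi>_norm by linarith
    \<comment> \<open>\<open>Suc j\<close> keeps the parameters strictly to the right of l, where
      the bound on the increments is assumed.\<close>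
    define x where "x j = l + \<epsilon> * real (Suc j) / real N" for j
    have x: "l < x j" "x j \<le> l + \<epsilon>" if "j < N" for j
    proof -
      have "real (Suc j) / real N \<le> 1"
        using that by simp
      then have "\<epsilon> * (real (Suc j) / real N) \<le> \<epsilon>"
        using \<epsilon> by (intro mult_left_le) auto
      then show "l < x j" "x j \<le> l + \<epsilon>"
        using \<epsilon> N by (auto simp: x_def)
    qed
    have E_le: "measure ?\<mu> E \<le> (\<integral>a. \<phi> (?X l a) \<partial>coin_space)"
    proof -
      have "measure ?\<mu> E = (\<integral>y. indicator E y \<partial>?\<mu>)"
        by (simp add: \<mu>.emeasure_eq_measure)
      also have "\<dots> \<le> (\<integral>y. \<phi> y \<partial>?\<mu>)"
      proof (rule integral_mono)
        show "integrable ?\<mu> (indicator E :: real \<Rightarrow> real)"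
          by (simp add: integrable_real_indicator \<mu>.emeasure_eq_measure)
        show "indicator E y \<le> \<phi> y" for y
          using \<phi>_bounds[of y] by (auto simp: indicator_def \<phi>_def tent_eq_1)
      qed (rule holder_space_integrable[OF \<phi>_holder \<theta>(1)])
      finally show ?thesis
        by (simp add: integral_bernoulli_convolution)
    qed
    have int: "integrable coin_space (\<lambda>a. \<phi> (?X y a))" for y
      by (rule integrable_const_bound[where B = 1]) (use \<phi>_bounds in auto)
    have shift: "(\<integral>a. \<phi> (?X l a) \<partial>coin_space) \<le> (\<integral>a. \<phi> (?X (x j) a) \<partial>coin_space) + 2 * C * \<epsilon> * r powr - \<theta>"
      if "j < N" for j
    proof -
      have "C * (x j - l) * holder_norm \<theta> \<phi> \<le> C * \<epsilon> * (2 * r powr - \<theta>)"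
        using x[OF that] C \<phi>_norm' holder_norm_ge[OF \<phi>_holder, of 0] \<epsilon>
        by (intro mult_mono mult_nonneg_nonneg mult_left_mono) auto
      then show ?thesis
        using H[of "x j" \<phi>] x[OF that] \<epsilon> \<phi>_holder by (auto simp: integral_bernoulli_convolution)
    qed
    have ptw: "(\<Sum>j<N. \<phi> (?X (x j) a)) \<le> real N * indicator {a. \<bar>?Y a\<bar> < \<tau>} a
        + (\<Sum>k\<in>S. ?c * indicator {a. ?X l a \<in> cball (p k) \<rho>} a)" if a: "a \<in> sign_seqs" for a
    proof (cases "\<bar>?Y a\<bar> < \<tau>")
      case True
      have "(\<Sum>j<N. \<phi> (?X (x j) a)) \<le> (\<Sum>j<N. 1)"
        using \<phi>_bounds by (intro sum_mono) auto
      moreover have "0 \<le> (\<Sum>k\<in>S. ?c * indicator {a. ?X l a \<in> cball (p k) \<rho>} a)"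
        using c by (intro sum_nonneg mult_nonneg_nonneg) auto
      ultimately show ?thesis
        using True by simp
    next
      case False
      \<comment> \<open>Cell \<open>k\<close> enlarged by \<open>r\<close> on both sides: wherever
        the tent function is nonzero, the point lies in one of these intervals.\<close>
      define J where "J k = {of_int (k - 1) * r..of_int (k + 2) * r}" for k :: int
      have 1: "\<phi> (?X (x j) a) \<le> (\<Sum>k\<in>S. indicator (J k) (?X (x j) a))" for j
      proof (cases "\<phi> (?X (x j) a) = 0")
        case True
        then show ?thesis by (simp add: sum_nonneg)
      next
        case False
        then obtain e where "e \<in> E" "dist (?X (x j) a) e < r"
          using tent_support[OF r(1) \<open>E \<noteq> {}\<close>] unfolding \<phi>_def by blast
        then obtain k where k: "k \<in> S" "?X (x j) a \<in> J k"
          by (fastforce simp: E_def grid_cell_def J_def dist_real_def algebra_simps abs_less_iff)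
        have "indicator (J k) (?X (x j) a) \<le> (\<Sum>k\<in>S. indicator (J k) (?X (x j) a) :: real)"
          using k \<open>finite S\<close> by (intro member_le_sum) auto
        then show ?thesis
          using k \<phi>_bounds(2)[of "?X (x j) a"] by simp
      qed
      have 2: "(\<Sum>j<N. indicator (J k) (?X (x j) a)) \<le> ?c * indicator {a. ?X l a \<in> cball (p k) \<rho>} a"
        if k: "k \<in> S" for k
      proof -
        define T where "T = {j. j < N \<and> ?X (x j) a \<in> J k}"
        have T: "finite T" by (simp add: T_def)
        have cardT: "(\<Sum>j<N. indicator (J k) (?X (x j) a)) = real (card T)"
        proof -
          have "(\<Sum>j<N. indicator (J k) (?X (x j) a)) = (\<Sum>j\<in>T. 1 :: real)"
            by (rule sum.mono_neutral_cong_right) (auto simp: T_def)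
          then show ?thesis by simp
        qed
        show ?thesis
        proof (cases "T = {}")
          case True
          then show ?thesis
            using c cardT by (auto simp: indicator_def)
        next
          case ne: False
          then obtain j where j: "j < N" "?X (x j) a \<in> J k"
            by (auto simp: T_def)
          \<comment> \<open>A visit to \<open>J k\<close> at any sampled parameter locates X(l): the
            point has moved by at most B\<epsilon> since l, and two points of \<open>J k\<close>,
            one of them in the middle cell, are at most 2r apart. This is the origin of the
            condition 2r + B\<epsilon> \<le> \<rho>.\<close>
          have "B * (x j - l) \<le> B * \<epsilon>"
            using x[OF j(1)] B by (intro mult_left_mono) auto
          then have "\<bar>?X (x j) a - ?X l a\<bar> \<le> B * \<epsilon>"
            using B(2)[OF a, of l "x j"] x[OF j(1)] \<epsilon> by simp
          moreover have "\<bar>?X (x j) a - p k\<bar> \<le> 2 * r"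
            using j(2) p[OF k] by (auto simp: J_def grid_cell_def algebra_simps abs_le_iff)
          ultimately have "?X l a \<in> cball (p k) \<rho>"
            using \<rho> by (auto simp: dist_real_def)
          moreover have "real (card T) \<le> 1 + (of_int (k + 2) * r - of_int (k - 1) * r) / (\<tau> * \<epsilon> / (2 * real N))"
          proof (rule card_separated_points_le[OF T, where p = "\<lambda>j. ?X (x j) a"])
            fix i j assume ij: "i \<in> T" "j \<in> T" "i < j"
            then have xi: "i < N" "j < N"
              by (auto simp: T_def)
            have d: "x j - x i = \<epsilon> / real N * (real j - real i)"
              by (simp add: x_def algebra_simps add_divide_distrib diff_divide_distrib)
            have "0 < \<epsilon> / real N * (real j - real i)"
              using \<epsilon> N ij by simp
            then have "x i < x j"
              using d by linarith
            then have t: "\<bar>?X (x j) a - ?X (x i) a - (x j - x i) * ?Y a\<bar> \<le> B * (x j - l) * (x j - x i)"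
              using B(3)[OF a, of "x i" "x j"] x xi \<epsilon> by force
            \<comment> \<open>Because 2B\<epsilon> \<le> \<tau>, the Taylor error is at most half of
              the main term (x j - x i) |Y|.\<close>
            have "B * (x j - l) \<le> B * \<epsilon>"
              using x[OF xi(2)] B by (intro mult_left_mono) auto
            then have "B * (x j - l) * (x j - x i) \<le> \<tau> / 2 * (x j - x i)"
              using \<tau> \<open>x i < x j\<close> by (intro mult_right_mono) auto
            moreover have "\<tau> * (x j - x i) \<le> \<bar>(x j - x i) * ?Y a\<bar>"
              using False \<open>x i < x j\<close> by (simp add: abs_mult mult.commute mult_left_mono)
            ultimately have "\<tau> / 2 * (x j - x i) \<le> \<bar>?X (x j) a - ?X (x i) a\<bar>"
              using t by linarith
            then show "\<tau> * \<epsilon> / (2 * real N) * (real j - real i) \<le> \<bar>?X (x j) a - ?X (x i) a\<bar>"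
              unfolding d by (simp add: field_simps)
          next
            show "(\<lambda>j. ?X (x j) a) ` T \<subseteq> {of_int (k - 1) * r..of_int (k + 2) * r}"
              by (auto simp: T_def J_def)
          qed (use \<tau> \<epsilon> N r in \<open>auto intro!: mult_right_mono\<close>)
          moreover have "(of_int (k + 2) * r - of_int (k - 1) * r) / (\<tau> * \<epsilon> / (2 * real N)) = 6 * r * real N / (\<tau> * \<epsilon>)"
            using \<tau> \<epsilon> N by (simp add: field_simps)
          ultimately show ?thesis
            unfolding cardT by (simp only: indicator_simps mem_Collect_eq mult_1_right)
        qed
      qed
      have "(\<Sum>j<N. \<phi> (?X (x j) a)) \<le> (\<Sum>j<N. \<Sum>k\<in>S. indicator (J k) (?X (x j) a))"
        using 1 by (rule sum_mono)
      also have "\<dots> = (\<Sum>k\<in>S. \<Sum>j<N. indicator (J k) (?X (x j) a))"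
        by (rule sum.swap)
      also have "\<dots> \<le> (\<Sum>k\<in>S. ?c * indicator {a. ?X l a \<in> cball (p k) \<rho>} a)"
        using 2 by (rule sum_mono)
      finally show ?thesis
        using False by simp
    qed
    have Y_sets: "{a. \<bar>?Y a\<bar> < \<tau>} \<in> sets coin_space"
    proof -
      have "{a \<in> space coin_space. \<bar>?Y a\<bar> < \<tau>} \<in> sets coin_space" by measurable
      then show ?thesis by simp
    qed
    have X_sets: "{a. ?X l a \<in> cball (p k) \<rho>} \<in> sets coin_space" for k
    proof -
      have "?X l -` cball (p k) \<rho> \<inter> space coin_space \<in> sets coin_space"
        by (rule measurable_sets[OF bernoulli_series_measurable]) simp
      then show ?thesis by (simp add: vimage_def)
    qed
    have "(\<Sum>j<N. \<integral>a. \<phi> (?X (x j) a) \<partial>coin_space) = (\<integral>a. (\<Sum>j<N. \<phi> (?X (x j) a)) \<partial>coin_space)"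
      using int by (subst Bochner_Integration.integral_sum) auto
    also have "\<dots> \<le> (\<integral>a. real N * indicator {a. \<bar>?Y a\<bar> < \<tau>} a
        + (\<Sum>k\<in>S. ?c * indicator {a. ?X l a \<in> cball (p k) \<rho>} a) \<partial>coin_space)"
    proof (rule integral_mono_AE)
      show "AE a in coin_space. (\<Sum>j<N. \<phi> (?X (x j) a)) \<le> real N * indicator {a. \<bar>?Y a\<bar> < \<tau>} a
        + (\<Sum>k\<in>S. ?c * indicator {a. ?X l a \<in> cball (p k) \<rho>} a)"
        using AE_sign_seqs by eventually_elim (rule ptw)
    qed (use int X_sets Y_sets in \<open>auto intro!: Bochner_Integration.integrable_add Bochner_Integration.integrable_sum integrable_mult_right integrable_real_indicator simp: emeasure_eq_measure\<close>)
    also have "\<dots> = real N * ?P + (\<Sum>k\<in>S. ?c * measure ?\<mu> (cball (p k) \<rho>))"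
      using X_sets Y_sets
      by (subst Bochner_Integration.integral_add)
        (auto intro!: Bochner_Integration.integrable_sum integrable_mult_right integrable_real_indicator
          simp: emeasure_eq_measure Bochner_Integration.integral_sum measure_bernoulli_convolution)
    also have "(\<Sum>k\<in>S. ?c * measure ?\<mu> (cball (p k) \<rho>)) \<le> ?c * (3 * \<rho> / (M * r))"
    proof -
      \<comment> \<open>Badness is read backwards here: it bounds the mass of the large ball by that
        of the small one. Each small ball meets only three cells, so the sum over all bad cells is
        at most 3 times the total mass, whereas the large balls could overlap about \<rho>/r
        times.\<close>
      have "(\<Sum>k\<in>S. measure ?\<mu> (cball (p k) \<rho>)) \<le> (\<Sum>k\<in>S. \<rho> / (M * r) *
          (measure ?\<mu> (grid_cell r (k + (-1))) + measure ?\<mu> (grid_cell r (k + 0)) + measure ?\<mu> (grid_cell r (k + 1))))"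
      proof (rule sum_mono)
        fix k assume k: "k \<in> S"
        have "M * (r / \<rho>) * measure ?\<mu> (cball (p k) \<rho>) \<le> measure ?\<mu> (cball (p k) r)"
          using p[OF k] by (simp add: F_def)
        also have "\<dots> \<le> measure ?\<mu> (grid_cell r (k + (-1))) + measure ?\<mu> (grid_cell r (k + 0)) + measure ?\<mu> (grid_cell r (k + 1))"
          using measure_cball_le_grid_cells[OF prob_space_bernoulli_convolution _ conjunct2[OF p[OF k]]] by simp
        finally show "measure ?\<mu> (cball (p k) \<rho>) \<le> \<rho> / (M * r) *
          (measure ?\<mu> (grid_cell r (k + (-1))) + measure ?\<mu> (grid_cell r (k + 0)) + measure ?\<mu> (grid_cell r (k + 1)))"
          using M r \<rho> by (simp add: field_simps)
      qed
      also have "\<dots> = \<rho> / (M * r) * ((\<Sum>k\<in>S. measure ?\<mu> (grid_cell r (k + (-1))))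
          + (\<Sum>k\<in>S. measure ?\<mu> (grid_cell r (k + 0))) + (\<Sum>k\<in>S. measure ?\<mu> (grid_cell r (k + 1))))"
        by (simp only: sum_distrib_left[symmetric] sum.distrib)
      also have "\<dots> \<le> \<rho> / (M * r) * (1 + 1 + 1)"
        using M r \<rho> \<open>finite S\<close>
        by (intro mult_left_mono add_mono sum_measure_grid_cells_le_1 prob_space_bernoulli_convolution) auto
      finally have "(\<Sum>k\<in>S. measure ?\<mu> (cball (p k) \<rho>)) \<le> 3 * \<rho> / (M * r)"
        by (simp add: mult.commute)
      then show ?thesis
        unfolding sum_distrib_left[symmetric] using c by (intro mult_left_mono) auto
    qed
    finally have sum_le: "(\<Sum>j<N. \<integral>a. \<phi> (?X (x j) a) \<partial>coin_space) \<le> real N * ?P + ?c * (3 * \<rho> / (M * r))"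
      by simp
    have "real N * measure ?\<mu> E = (\<Sum>j<N. measure ?\<mu> E)"
      by simp
    also have "\<dots> \<le> (\<Sum>j<N. (\<integral>a. \<phi> (?X (x j) a) \<partial>coin_space) + 2 * C * \<epsilon> * r powr - \<theta>)"
      using E_le shift by (intro sum_mono) force
    also have "\<dots> = (\<Sum>j<N. (\<integral>a. \<phi> (?X (x j) a) \<partial>coin_space)) + real N * (2 * C * \<epsilon> * r powr - \<theta>)"
      by (simp add: sum.distrib)
    also have "\<dots> \<le> real N * ?P + ?c * (3 * \<rho> / (M * r)) + real N * (2 * C * \<epsilon> * r powr - \<theta>)"
      using sum_le by simp
    also have "\<dots> = real N * (?P + (1 / real N + 6 * r / (\<tau> * \<epsilon>)) * (3 * \<rho> / (M * r)) + 2 * C * \<epsilon> * r powr - \<theta>)"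
    proof -
      have ceq: "?c = real N * (1 / real N + 6 * r / (\<tau> * \<epsilon>))"
        using N by (simp add: distrib_left)
      have "n * a + n * b * c + n * d = n * (a + b * c + d)" for n a b c d :: real
        by (simp add: algebra_simps)
      then show ?thesis
        unfolding ceq .
    qed
    finally show ?thesis
      using N by simp
  qed
  then show ?thesis
    using that[OF E_sets] FE by (auto simp: F_def)
qed

section \<open>A Frostman bound on a set of positive measure\<close>

text \<open>A covering set that meets \<open>G\<close> lies in a ball centred in \<open>G\<close>
  with radius its diameter. Its mass is thus bounded by \<open>K\<close> times its weight, and the
  total weight of a cover of \<open>A\<close> can be made arbitrarily small.\<close>

lemma mass_distribution_null:
  fixes M :: "real measure"
  assumes "prob_space M" and sets: "sets M = sets borel" and G: "G \<in> sets borel" and A: "A \<in> sets borel"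
    and K: "K > 0" and r0: "r0 > 0" and s: "0 \<le> s" "s < t"
    and frostman: "\<And>x r. x \<in> G \<Longrightarrow> 0 < r \<Longrightarrow> r \<le> r0 \<Longrightarrow> measure M (cball x r) \<le> K * r powr t"
    and null: "hausdorff_measure s A = 0"
  shows "measure M (A \<inter> G) = 0"
proof -
  interpret prob_space M by fact
  \<comment> \<open>Radii up to \<open>r0\<close> make the Frostman bound available; radii up to 1
    allow the exponent t to be lowered to s.\<close>
  define d where "d = min r0 1"
  have d: "0 < d" "d \<le> r0" "d \<le> 1"
    using r0 by (auto simp: d_def)
  have weight: "emeasure M (cball x (diameter U)) \<le> ennreal K * hausdorff_weight s U"
    if "x \<in> G" "x \<in> U" "bounded U" "diameter U \<le> d" for x U
  proof (cases "diameter U = 0")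
    case True
    \<comment> \<open>For s > 0 a singleton has weight 0, so it must have mass 0; this follows by
      letting the radius tend to 0 in the Frostman bound, as t > 0.\<close>
    have "measure M (cball x 0) \<le> 0"
    proof (rule tendsto_lowerbound)
      have "((\<lambda>r. K * r powr t) \<longlongrightarrow> K * 0 powr t) (at_right 0)"
        using s by (intro tendsto_intros tendsto_powr2) (auto simp: eventually_at_right_less eventually_mono[OF eventually_at_right_less])
      then show "((\<lambda>r. K * r powr t) \<longlongrightarrow> 0) (at_right 0)"
        by simp
      show "\<forall>\<^sub>F r in at_right 0. measure M (cball x 0) \<le> K * r powr t"
        using eventually_at_right_less[of "0::real"] eventually_at_right_real[OF r0]
      proof eventually_elim
        case (elim r)
        have "measure M (cball x 0) \<le> measure M (cball x r)"
          using elim sets by (intro finite_measure_mono) auto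
        then show ?case
          using frostman[OF that(1), of r] elim by auto
      qed
    qed simp
    then have "measure M (cball x (diameter U)) = 0"
      using True measure_nonneg[of M "cball x 0"] by (simp add: antisym)
    then show ?thesis
      by (simp add: emeasure_eq_measure)
  next
    case False
    then have D: "0 < diameter U"
      using diameter_ge_0[OF that(3)] by simp
    have U: "U \<noteq> {}"
      using that by auto
    have "measure M (cball x (diameter U)) \<le> K * diameter U powr t"
      using frostman[OF that(1) D] that d by simp
    also have "diameter U powr t \<le> diameter U powr s"
      using D s that d by (intro powr_mono') auto
    finally have "measure M (cball x (diameter U)) \<le> K * diameter U powr s"
      using K by simp
    then have "emeasure M (cball x (diameter U)) \<le> ennreal (K * diameter U powr s)"
      by (simp add: emeasure_eq_measure ennreal_leI)
    also have "\<dots> = ennreal K * hausdorff_weight s U"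
      using U D K by (auto simp: hausdorff_weight_def ennreal_mult)
    finally show ?thesis .
  qed
  have "hausdorff_premeasure s d A \<le> hausdorff_measure s A"
    unfolding hausdorff_measure_def using d by (intro SUP_upper) auto
  then have pre: "hausdorff_premeasure s d A = 0"
    using null by simp
  have "emeasure M (A \<inter> G) \<le> 0"
  proof (rule ennreal_le_epsilon)
    fix e :: real assume e: "e > 0"
    have "(INF U \<in> {U :: nat \<Rightarrow> real set. A \<subseteq> (\<Union>i. U i) \<and> (\<forall>i. bounded (U i) \<and> diameter (U i) \<le> d)}.
        \<Sum>i. hausdorff_weight s (U i)) < ennreal (e / K)"
      using pre e K unfolding hausdorff_premeasure_def by simp
    then obtain U :: "nat \<Rightarrow> real set" where U: "A \<subseteq> (\<Union>i. U i)" "\<And>i. bounded (U i)" "\<And>i. diameter (U i) \<le> d"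
      "(\<Sum>i. hausdorff_weight s (U i)) < ennreal (e / K)"
      unfolding INF_less_iff by auto
    \<comment> \<open>The covering sets need be neither measurable nor centred in \<open>G\<close>,
      so each is replaced by a ball. The choice has no meaning when \<open>U i\<close> misses
      \<open>G\<close>; then \<open>V i\<close> is empty.\<close>
    define x where "x i = (SOME x. x \<in> U i \<inter> G)" for i
    have x: "x i \<in> U i \<inter> G" if "U i \<inter> G \<noteq> {}" for i
      unfolding x_def some_in_eq by (rule that)
    define V where "V i = (if U i \<inter> G = {} then {} else cball (x i) (diameter (U i)))" for i
    have V_sets: "V i \<in> sets M" for i
      using sets by (simp add: V_def)
    have "A \<inter> G \<subseteq> (\<Union>i. V i)"
    proof
      fix y assume y: "y \<in> A \<inter> G"
      then obtain i where i: "y \<in> U i"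
        using U(1) by auto
      then have "x i \<in> U i \<inter> G"
        using x y by blast
      then have "dist (x i) y \<le> diameter (U i)"
        using diameter_bounded_bound[OF U(2)[of i]] i by blast
      then show "y \<in> (\<Union>i. V i)"
        using i y by (auto simp: V_def intro!: exI[of _ i])
    qed
    then have "emeasure M (A \<inter> G) \<le> emeasure M (\<Union>i. V i)"
      using V_sets by (intro emeasure_mono) auto
    also have "\<dots> \<le> (\<Sum>i. emeasure M (V i))"
      using V_sets by (intro emeasure_subadditive_countably) auto
    also have "\<dots> \<le> (\<Sum>i. ennreal K * hausdorff_weight s (U i))"
    proof (rule suminf_le)
      show "emeasure M (V i) \<le> ennreal K * hausdorff_weight s (U i)" for i
        using weight[of "x i" "U i"] x[of i] U(2,3)[of i] by (auto simp: V_def)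
    qed auto
    also have "\<dots> = ennreal K * (\<Sum>i. hausdorff_weight s (U i))"
      by (rule ennreal_suminf_cmult)
    also have "\<dots> \<le> ennreal K * ennreal (e / K)"
      using U(4) by (intro mult_left_mono) auto
    also have "\<dots> = ennreal e"
      using K e by (simp add: ennreal_mult[symmetric])
    finally show "emeasure M (A \<inter> G) \<le> 0 + ennreal e"
      by simp
  qed
  then show ?thesis
    by (simp add: emeasure_eq_measure)
qed

text \<open>Crude, but with x a multiple of \<beta>^n it turns a doubly exponential error into a
  term of a geometric series.\<close>

lemma exp_neg_le_inverse:
  fixes x :: real
  assumes "x > 0"
  shows "exp (- x) \<le> 1 / x"
proof -
  have "x \<le> exp x"
    using exp_ge_add_one_self[of x] by linarith
  then show ?thesis
    using assms by (simp add: exp_minus field_simps)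
qed

text \<open>
  The scales $\rho_n = e^{-\beta^n}$ decay superexponentially, because the logarithmic estimate for the
  probability of a small derivative must be summable along thresholds $\tau_n$ which cost only a small
  power of $\rho_n$. Taking \<open>\<beta>\<close> close to 1 loses only the factor \<open>\<beta>\<close> in the exponent between
  consecutive scales.
\<close>

lemma frostman_of_holder_bound:
  fixes l \<theta> C e0 t :: real
  assumes l: "0 < l" "l < 1" and \<theta>: "0 < \<theta>" "\<theta> < 1" and e0: "e0 > 0"
    and H: "\<And>x \<phi>. l < x \<Longrightarrow> x < l + e0 \<Longrightarrow> \<phi> \<in> holder_space \<theta> \<Longrightarrow>
      \<bar>(\<integral>y. \<phi> y \<partial>bernoulli_convolution x) - (\<integral>y. \<phi> y \<partial>bernoulli_convolution l)\<bar>
        \<le> C * (x - l) * holder_norm \<theta> \<phi>" and C: "C \<ge> 0"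
    and t: "0 < t" "t < 1"
  obtains G K r0 where "G \<in> sets borel" "measure (bernoulli_convolution l) G > 0" "K > 0" "r0 > 0"
    "\<And>x r. x \<in> G \<Longrightarrow> 0 < r \<Longrightarrow> r \<le> r0 \<Longrightarrow> measure (bernoulli_convolution l) (cball x r) \<le> K * r powr t"
proof -
  let ?\<mu> = "bernoulli_convolution l"
  interpret coin: prob_space coin_space by (rule prob_space_coin_space)
  interpret prob_space ?\<mu> by (rule prob_space_bernoulli_convolution)
  obtain B where B: "B > 0"
    "\<And>a x y. a \<in> sign_seqs \<Longrightarrow> l \<le> x \<Longrightarrow> x < y \<Longrightarrow> y \<le> (1 + l) / 2 \<Longrightarrow>
       \<bar>bernoulli_series y a - bernoulli_series x a\<bar> \<le> B * (y - x)"
    "\<And>a x y. a \<in> sign_seqs \<Longrightarrow> l \<le> x \<Longrightarrow> x < y \<Longrightarrow> y \<le> (1 + l) / 2 \<Longrightarrow>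
       \<bar>bernoulli_series y a - bernoulli_series x a - (y - x) * bernoulli_series_deriv l a\<bar>
         \<le> B * (y - l) * (y - x)"
    using bernoulli_series_taylor[OF l] by blast
  obtain L where L: "L > 0"
    "\<And>T. T > 0 \<Longrightarrow> measure coin_space {a. \<bar>bernoulli_series_deriv l a\<bar> < exp (- T)} \<le> L / T"
    using prob_deriv_small[OF l] by blast
  \<comment> \<open>\<theta>\<beta> < 1 makes \<rho>_n \<rho>_{n+1}^(-\<theta>) = exp(-(1 -
    \<theta>\<beta>) \<beta>^n) summable, \<beta>t < 1 leaves room for a positive \<delta>, and
    \<beta> < 2 gives \<delta>\<beta> \<le> 1.\<close>
  have "1 < min 2 (min (1 / \<theta>) (1 / t))"
    using \<theta> t by simp
  then obtain \<beta> where \<beta>1: "1 < \<beta>" "\<beta> < min 2 (min (1 / \<theta>) (1 / t))"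
    using dense by blast
  then have \<beta>: "1 < \<beta>" "\<beta> < 2" "\<theta> * \<beta> < 1" "\<beta> * t < 1"
    using \<theta> t by (auto simp: field_simps)
  \<comment> \<open>Solves \<delta>\<beta> - \<beta> + 1 - t\<beta> = -t\<beta>^2, the exponent
    equation with which the induction over the scales closes.\<close>
  define \<delta> where "\<delta> = (1 - \<beta> * t) * (\<beta> - 1) / \<beta>"
  have \<delta>: "\<delta> > 0"
    using \<beta> by (simp add: \<delta>_def)
  have \<delta>\<beta>: "\<delta> * \<beta> = (1 - \<beta> * t) * (\<beta> - 1)"
    using \<beta> by (simp add: \<delta>_def)
  have "(1 - \<beta> * t) * (\<beta> - 1) \<le> 1 * 1"
    using \<beta> t by (intro mult_mono) auto
  then have \<delta>1: "\<delta> * \<beta> \<le> 1"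
    using \<delta>\<beta> by simp
  \<comment> \<open>The parameter range is \<epsilon> = c \<rho>_n, and 2Bc \<le> 1 yields both
    2B\<epsilon> \<le> \<rho>_n \<le> \<tau> and B\<epsilon> \<le> \<rho>_n / 2.\<close>
  define c where "c = 1 / (2 * B + 1)"
  have c: "c > 0" "2 * B * c \<le> 1"
    using B(1) by (auto simp: c_def)
  define \<rho> where "\<rho> n = exp (- (\<beta> ^ n))" for n :: nat
  define M where "M n = exp (\<delta> * \<beta> ^ n)" for n :: nat
  define W where "W = 1 / (1 - l)"
  define Q where "Q = 2 * L / \<delta> + 6 * (1 + 6 / c) / \<delta> + 2 * C * c / (1 - \<theta> * \<beta>)"
  have \<rho>_pos: "\<rho> n > 0" for n
    by (simp add: \<rho>_def)
  have \<beta>_inf: "filterlim (\<lambda>n. \<beta> ^ n) at_top sequentially"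
    using filterlim_at_infinity_imp_norm_at_top[OF filterlim_realpow_sequentially_gt1[of \<beta>]] \<beta>(1)
    by (simp add: norm_power)
  have exp_lim: "(\<lambda>n. exp (- (\<kappa> * \<beta> ^ n))) \<longlonglongrightarrow> 0" if "\<kappa> > 0" for \<kappa>
  proof -
    have "filterlim (\<lambda>n. \<kappa> * \<beta> ^ n) at_top sequentially"
      by (rule filterlim_tendsto_pos_mult_at_top[OF tendsto_const that \<beta>_inf])
    then show ?thesis
      by (intro filterlim_compose[OF exp_at_bot]) (simp add: filterlim_uminus_at_bot)
  qed
  have \<rho>_lim: "\<rho> \<longlonglongrightarrow> 0"
    using exp_lim[of 1] by (simp add: \<rho>_def[abs_def])
  have \<beta>_pos: "\<beta> ^ n > 0" for n
    using \<beta> by simp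
  define good where "good n E \<longleftrightarrow> E \<in> sets borel \<and>
      (\<forall>x. \<bar>x\<bar> \<le> W \<longrightarrow> M (Suc n) * (\<rho> (Suc n) / \<rho> n) * measure ?\<mu> (cball x (\<rho> n))
         < measure ?\<mu> (cball x (\<rho> (Suc n))) \<longrightarrow> x \<in> E)
      \<and> measure ?\<mu> E \<le> Q * (1 / \<beta>) ^ n" for n E
  have "\<forall>\<^sub>F n in sequentially. \<exists>E. good n E"
  proof -
    \<comment> \<open>\<open>ev1\<close> keeps l + c \<rho>_n inside the range of the increment
      bound and of the Taylor bounds. \<open>ev2\<close> says \<rho>_{n+1} \<le> \<rho>_n / 4, so
      that two small radii take up at most half of \<rho>_n.\<close>
    have ev1: "\<forall>\<^sub>F n in sequentially. \<rho> n < min (e0 / c) ((1 - l) / (2 * c))"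
      by (rule order_tendstoD(2)[OF \<rho>_lim]) (use e0 c l in simp)
    have ev2: "\<forall>\<^sub>F n in sequentially. exp (- ((\<beta> - 1) * \<beta> ^ n)) < 1 / 4"
      using order_tendstoD(2)[OF exp_lim[of "\<beta> - 1"], of "1 / 4"] \<beta> by simp
    show ?thesis
      using ev1 ev2
    proof eventually_elim
      case (elim n)
      \<comment> \<open>Half the exponent of \<open>M (Suc n)\<close>, so that
        \<open>M (Suc n)\<close> is \<tau>^(-2): one factor \<tau> compensates the loss 1/\<tau> in
        the separation, the other remains and is summable.\<close>
      define T where "T = \<delta> * \<beta> ^ Suc n / 2"
      define \<tau> where "\<tau> = exp (- T)"
      \<comment> \<open>So many sample parameters that the discretisation error 1/N does not exceed
        \<rho>_{n+1} / \<rho>_n.\<close>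
      define N where "N = nat \<lceil>\<rho> n / \<rho> (Suc n)\<rceil>"
      have T: "T > 0"
        using \<delta> \<beta> by (simp add: T_def)
      have N_ge: "\<rho> n / \<rho> (Suc n) \<le> real N"
        unfolding N_def by (rule real_nat_ceiling_ge)
      have quot: "\<rho> n / \<rho> (Suc n) > 0"
        using \<rho>_pos by simp
      have N: "N > 0"
        using N_ge quot by (cases N) auto
      have \<epsilon>: "0 < c * \<rho> n" "c * \<rho> n < e0" "l + c * \<rho> n \<le> (1 + l) / 2"
        using elim(1) c \<rho>_pos[of n] by (auto simp: field_simps)
      have \<tau>_ge: "2 * B * (c * \<rho> n) \<le> \<tau>"
      proof -
        have "\<delta> * \<beta> * \<beta> ^ n \<le> 1 * \<beta> ^ n"
          using \<delta>1 \<beta>_pos[of n] by (intro mult_right_mono) auto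
        moreover have "2 * T = \<delta> * \<beta> * \<beta> ^ n"
          by (simp add: T_def)
        ultimately have "T \<le> \<beta> ^ n"
          using T by linarith
        then have "\<rho> n \<le> \<tau>"
          by (simp add: \<rho>_def \<tau>_def)
        moreover have "2 * B * c * \<rho> n \<le> 1 * \<rho> n"
          using c \<rho>_pos[of n] by (intro mult_right_mono) auto
        ultimately show ?thesis by (simp add: mult.assoc)
      qed
      have \<rho>_ge: "2 * \<rho> (Suc n) + B * (c * \<rho> n) \<le> \<rho> n"
      proof -
        have "\<rho> (Suc n) = exp (- ((\<beta> - 1) * \<beta> ^ n)) * \<rho> n"
          by (simp add: \<rho>_def mult_exp_exp algebra_simps)
        then have "\<rho> (Suc n) \<le> 1 / 4 * \<rho> n"
          using elim(2) \<rho>_pos[of n] by (simp add: mult_right_mono)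
        moreover have "2 * B * c * \<rho> n \<le> 1 * \<rho> n"
          using c \<rho>_pos[of n] by (intro mult_right_mono) auto
        ultimately show ?thesis by (simp add: mult.assoc)
      qed
      have \<rho>1: "\<rho> (Suc n) < 1"
        using \<beta>_pos[of "Suc n"] by (simp add: \<rho>_def del: power_Suc)
      have M: "M (Suc n) > 0"
        by (simp add: M_def)
      have \<tau>: "\<tau> > 0"
        by (simp add: \<tau>_def)
      obtain E where E: "E \<in> sets borel"
        "\<And>x. \<bar>x\<bar> \<le> W \<Longrightarrow> M (Suc n) * (\<rho> (Suc n) / \<rho> n) * measure ?\<mu> (cball x (\<rho> n))
         < measure ?\<mu> (cball x (\<rho> (Suc n))) \<Longrightarrow> x \<in> E"
        "measure ?\<mu> E \<le> measure coin_space {a. \<bar>bernoulli_series_deriv l a\<bar> < \<tau>}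
           + (1 / real N + 6 * \<rho> (Suc n) / (\<tau> * (c * \<rho> n))) * (3 * \<rho> n / (M (Suc n) * \<rho> (Suc n)))
           + 2 * C * (c * \<rho> n) * \<rho> (Suc n) powr - \<theta>"
        using bad_scale_set_bound[OF l \<theta> H C B \<rho>_pos[of "Suc n"] \<rho>1 \<epsilon> \<tau> \<tau>_ge \<rho>_pos[of n] \<rho>_ge M N, of W]
        by blast
      have mono: "1 / \<beta> ^ Suc n \<le> 1 / \<beta> ^ n"
        using \<beta> by (intro divide_left_mono power_increasing) auto
      have 1: "measure coin_space {a. \<bar>bernoulli_series_deriv l a\<bar> < \<tau>} \<le> 2 * L / \<delta> * (1 / \<beta> ^ n)"
      proof -
        have "measure coin_space {a. \<bar>bernoulli_series_deriv l a\<bar> < \<tau>} \<le> L / T"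
          unfolding \<tau>_def using L(2)[OF T] .
        also have "L / T = 2 * L / \<delta> * (1 / \<beta> ^ Suc n)"
          by (simp add: T_def)
        also have "\<dots> \<le> 2 * L / \<delta> * (1 / \<beta> ^ n)"
          using L \<delta> by (intro mult_left_mono mono) auto
        finally show ?thesis .
      qed
      have 2: "(1 / real N + 6 * \<rho> (Suc n) / (\<tau> * (c * \<rho> n))) * (3 * \<rho> n / (M (Suc n) * \<rho> (Suc n)))
          \<le> 6 * (1 + 6 / c) / \<delta> * (1 / \<beta> ^ n)"
      proof -
        have M_eq: "M (Suc n) = 1 / (\<tau> * \<tau>)"
          by (simp add: M_def \<tau>_def T_def exp_minus field_simps mult_exp_exp)
        have "1 / real N \<le> 1 / (\<rho> n / \<rho> (Suc n))"
          using N_ge quot N by (intro divide_left_mono mult_pos_pos) auto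
        also have "\<dots> = \<rho> (Suc n) / \<rho> n"
          by simp
        also have "\<dots> \<le> \<rho> (Suc n) / \<rho> n / \<tau>"
        proof -
          have "\<tau> \<le> 1"
            using T by (simp add: \<tau>_def)
          then show ?thesis
            using \<tau> \<rho>_pos[of n] \<rho>_pos[of "Suc n"] by (simp add: field_simps)
        qed
        finally have "(1 / real N + 6 * \<rho> (Suc n) / (\<tau> * (c * \<rho> n))) * (3 * \<rho> n / (M (Suc n) * \<rho> (Suc n)))
          \<le> (\<rho> (Suc n) / \<rho> n / \<tau> + 6 * \<rho> (Suc n) / (\<tau> * (c * \<rho> n))) * (3 * \<rho> n / (M (Suc n) * \<rho> (Suc n)))"
          using \<rho>_pos[of n] \<rho>_pos[of "Suc n"] M by (intro mult_right_mono) auto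
        also have "\<dots> = 3 * (1 + 6 / c) * \<tau>"
          using \<rho>_pos[of n] \<rho>_pos[of "Suc n"] \<tau> c unfolding M_eq by (simp add: field_simps)
        also have "\<dots> \<le> 3 * (1 + 6 / c) * (1 / T)"
          using exp_neg_le_inverse[OF T] c unfolding \<tau>_def by (intro mult_left_mono) auto
        also have "\<dots> = 6 * (1 + 6 / c) / \<delta> * (1 / \<beta> ^ Suc n)"
          by (simp add: T_def)
        also have "\<dots> \<le> 6 * (1 + 6 / c) / \<delta> * (1 / \<beta> ^ n)"
          using c \<delta> by (intro mult_left_mono mono) auto
        finally show ?thesis .
      qed
      have 3: "2 * C * (c * \<rho> n) * \<rho> (Suc n) powr - \<theta> \<le> 2 * C * c / (1 - \<theta> * \<beta>) * (1 / \<beta> ^ n)"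
      proof -
        have "\<rho> n * \<rho> (Suc n) powr - \<theta> = exp (- ((1 - \<theta> * \<beta>) * \<beta> ^ n))"
          by (simp add: \<rho>_def powr_def mult_exp_exp algebra_simps)
        also have "\<dots> \<le> 1 / ((1 - \<theta> * \<beta>) * \<beta> ^ n)"
          using \<beta> by (intro exp_neg_le_inverse) auto
        finally have "2 * C * c * (\<rho> n * \<rho> (Suc n) powr - \<theta>) \<le> 2 * C * c * (1 / ((1 - \<theta> * \<beta>) * \<beta> ^ n))"
          using C c by (intro mult_left_mono) auto
        then show ?thesis by (simp add: mult.assoc)
      qed
      have "measure ?\<mu> E \<le> Q * (1 / \<beta> ^ n)"
        using E(3) 1 2 3 unfolding Q_def distrib_right by linarith
      then show ?case
        using E(1,2) unfolding good_def power_one_over by blast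
    qed
  qed
  then obtain n0 where "\<forall>n\<ge>n0. \<exists>E. good n E"
    unfolding eventually_sequentially by blast
  then obtain E where "\<And>n. n \<ge> n0 \<Longrightarrow> good n (E n)"
    by metis
  then have E: "\<And>n. n \<ge> n0 \<Longrightarrow> E n \<in> sets borel"
      "\<And>n x. n \<ge> n0 \<Longrightarrow> \<bar>x\<bar> \<le> W \<Longrightarrow> M (Suc n) * (\<rho> (Suc n) / \<rho> n) * measure ?\<mu> (cball x (\<rho> n))
         < measure ?\<mu> (cball x (\<rho> (Suc n))) \<Longrightarrow> x \<in> E n"
      "\<And>n. n \<ge> n0 \<Longrightarrow> measure ?\<mu> (E n) \<le> Q * (1 / \<beta>) ^ n"
    unfolding good_def by blast+
  have "(\<lambda>n. Q / (1 - 1 / \<beta>) * (1 / \<beta>) ^ n) \<longlonglongrightarrow> Q / (1 - 1 / \<beta>) * 0"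
    using \<beta> by (intro tendsto_intros LIMSEQ_power_zero) auto
  then have "\<forall>\<^sub>F n in sequentially. Q / (1 - 1 / \<beta>) * (1 / \<beta>) ^ n < 1"
    by (intro order_tendstoD(2)) auto
  then obtain n2 where n2: "\<And>n. n \<ge> n2 \<Longrightarrow> Q / (1 - 1 / \<beta>) * (1 / \<beta>) ^ n < 1"
    by (auto simp: eventually_sequentially)
  \<comment> \<open>From this index on, the bad sets of all scales together have measure below 1 and
    can be removed at once.\<close>
  define n1 where "n1 = max n0 n2"
  define U where "U = (\<Union>i. E (n1 + i))"
  have U_sets [measurable]: "U \<in> sets borel"
    unfolding U_def using E(1) by (intro sets.countable_UN) (auto simp: n1_def)
  have U_lt: "measure ?\<mu> U < 1"
  proof -
    have sums: "(\<lambda>i. Q * (1 / \<beta>) ^ n1 * (1 / \<beta>) ^ i) sums (Q * (1 / \<beta>) ^ n1 * (1 / (1 - 1 / \<beta>)))"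
      using \<beta> by (intro sums_mult geometric_sums) auto
    have le: "measure ?\<mu> (E (n1 + i)) \<le> Q * (1 / \<beta>) ^ n1 * (1 / \<beta>) ^ i" for i
      using E(3)[of "n1 + i"] by (simp add: n1_def power_add mult.assoc)
    have summ: "summable (\<lambda>i. measure ?\<mu> (E (n1 + i)))"
      by (rule summable_comparison_test'[OF sums_summable[OF sums]]) (use le in auto)
    have "measure ?\<mu> U \<le> (\<Sum>i. measure ?\<mu> (E (n1 + i)))"
      unfolding U_def using E(1) summ by (intro finite_measure_subadditive_countably) (auto simp: n1_def)
    also have "\<dots> \<le> (\<Sum>i. Q * (1 / \<beta>) ^ n1 * (1 / \<beta>) ^ i)"
      using le summ sums_summable[OF sums] by (rule suminf_le)
    also have "\<dots> = Q * (1 / \<beta>) ^ n1 * (1 / (1 - 1 / \<beta>))"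
      using sums by (simp add: sums_iff)
    also have "\<dots> = Q / (1 - 1 / \<beta>) * (1 / \<beta>) ^ n1"
      by simp
    also have "\<dots> < 1"
      using n2 by (simp add: n1_def)
    finally show ?thesis .
  qed
  have W1: "measure ?\<mu> {- W..W} = 1"
  proof -
    have "measure coin_space {a. bernoulli_series l a \<in> {- W..W}} = 1"
    proof (subst coin.prob_eq_1)
      have "bernoulli_series l -` {- W..W} \<inter> space coin_space \<in> sets coin_space"
        by (rule measurable_sets[OF bernoulli_series_measurable]) simp
      then show "{a. bernoulli_series l a \<in> {- W..W}} \<in> coin.events" by (simp add: vimage_def)
      show "AE a in coin_space. a \<in> {a. bernoulli_series l a \<in> {- W..W}}"
        using AE_sign_seqs
      proof eventually_elim
        case (elim a)
        then show ?case
          using bernoulli_series_abs_le[OF elim l] by (simp add: W_def abs_le_iff)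
      qed
    qed
    then show ?thesis by (simp add: measure_bernoulli_convolution)
  qed
  define G where "G = {- W..W} - U"
  have "measure ?\<mu> {- W..W} \<le> measure ?\<mu> (G \<union> U)"
    by (intro finite_measure_mono) (auto simp: G_def)
  also have "\<dots> \<le> measure ?\<mu> G + measure ?\<mu> U"
    by (intro measure_Un_le) (auto simp: G_def)
  finally have G_pos: "measure ?\<mu> G > 0"
    using W1 U_lt by linarith
  \<comment> \<open>Makes the bound at the first scale equal to 1.\<close>
  define K where "K = exp (t * \<beta> ^ Suc n1)"
  have K: "K > 0"
    by (simp add: K_def)
  \<comment> \<open>The ball of radius \<rho>_n is bounded by K \<rho>_{n+1}^t, with the next scale
    on the right. The consecutive radii differ by a power, so this head start is what covers every r
    with \<rho>_{n+1} < r \<le> \<rho>_n.\<close>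
  have scale: "measure ?\<mu> (cball x (\<rho> n)) \<le> K * exp (- (t * \<beta> ^ Suc n))" if x: "x \<in> G" and n: "n \<ge> n1" for x n
    using n
  proof (induction n rule: dec_induct)
    case base
    have "K * exp (- (t * \<beta> ^ Suc n1)) = 1"
      by (simp add: K_def mult_exp_exp)
    then show ?case
      by (metis prob_le_1)
  next
    case (step n)
    have "x \<notin> E n"
      using x step(1) by (auto simp: G_def U_def dest!: spec[of _ "n - n1"])
    then have "measure ?\<mu> (cball x (\<rho> (Suc n))) \<le> M (Suc n) * (\<rho> (Suc n) / \<rho> n) * measure ?\<mu> (cball x (\<rho> n))"
      using E(2)[of n x] x step(1) by (force simp: G_def n1_def)
    also have "\<dots> \<le> M (Suc n) * (\<rho> (Suc n) / \<rho> n) * (K * exp (- (t * \<beta> ^ Suc n)))"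
      using step \<rho>_pos[of n] \<rho>_pos[of "Suc n"] by (intro mult_left_mono) (auto simp: M_def)
    also have "\<dots> = K * exp (\<delta> * \<beta> ^ Suc n - \<beta> ^ Suc n + \<beta> ^ n - t * \<beta> ^ Suc n)"
      by (simp add: M_def \<rho>_def exp_diff exp_add exp_minus field_simps)
    also have "\<delta> * \<beta> ^ Suc n - \<beta> ^ Suc n + \<beta> ^ n - t * \<beta> ^ Suc n = (\<delta> * \<beta> - \<beta> + 1 - t * \<beta>) * \<beta> ^ n"
      by (simp add: algebra_simps)
    also have "\<dots> = - (t * \<beta> ^ Suc (Suc n))"
      unfolding \<delta>\<beta> by (simp add: algebra_simps)
    finally show ?case .
  qed
  have "measure ?\<mu> (cball x r) \<le> K * r powr t" if x: "x \<in> G" and r: "0 < r" "r \<le> \<rho> n1" for x r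
  proof -
    have "\<forall>\<^sub>F n in sequentially. \<rho> n < r"
      using order_tendstoD(2)[OF \<rho>_lim r(1)] .
    then obtain m where m: "\<rho> m < r"
      by (auto simp: eventually_sequentially)
    define k where "k = (LEAST m. \<rho> m < r)"
    have k: "\<rho> k < r"
      unfolding k_def using m by (rule LeastI)
    have k_min: "r \<le> \<rho> i" if "i < k" for i
      using not_less_Least[of i "\<lambda>m. \<rho> m < r"] that by (simp add: k_def not_less)
    have "n1 < k"
    proof (rule ccontr)
      assume "\<not> n1 < k"
      then have "\<beta> ^ k \<le> \<beta> ^ n1"
        using \<beta> by (intro power_increasing) auto
      then have "\<rho> n1 \<le> \<rho> k"
        by (simp add: \<rho>_def)
      then show False using k r by simp
    qed
    then obtain n where n: "k = Suc n" "n1 \<le> n"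
      by (cases k) auto
    have "measure ?\<mu> (cball x r) \<le> measure ?\<mu> (cball x (\<rho> n))"
      using k_min[of n] n by (intro finite_measure_mono) auto
    also have "\<dots> \<le> K * exp (- (t * \<beta> ^ Suc n))"
      by (rule scale[OF x n(2)])
    also have "exp (- (t * \<beta> ^ Suc n)) = \<rho> k powr t"
      by (simp add: \<rho>_def powr_def n)
    also have "\<rho> k powr t \<le> r powr t"
      using k t \<rho>_pos[of k] by (intro powr_mono2) auto
    finally show ?thesis
      using K by simp
  qed
  moreover have "G \<in> sets borel"
    by (simp add: G_def)
  ultimately show ?thesis
    using that[of G K "\<rho> n1"] G_pos K \<rho>_pos by blast
qed

text \<open>Otherwise there is a set \<open>G\<close> of positive measure with a Frostman bound of
  exponent t. Some \<open>A\<close> of full measure is null for an exponent s < 1; with t between s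
  and 1, the intersection of \<open>A\<close> and \<open>G\<close> is null and yet has the measure
  of \<open>G\<close>.\<close>

lemma upper_dim_lt_1_no_holder_bound:
  fixes l \<theta> C e0 :: real
  assumes l: "0 < l" "l < 1" and \<theta>: "0 < \<theta>" "\<theta> < 1" and e0: "e0 > 0"
    and dim: "upper_hausdorff_dim_measure (bernoulli_convolution l) < 1"
  obtains x \<phi> where "l < x" "x < l + e0" "\<phi> \<in> holder_space \<theta>"
    "\<bar>(\<integral>y. \<phi> y \<partial>bernoulli_convolution x) - (\<integral>y. \<phi> y \<partial>bernoulli_convolution l)\<bar>
        > C * (x - l) * holder_norm \<theta> \<phi>"
proof (rule ccontr)
  assume not: "\<not> thesis"
  note witness = that
  let ?\<mu> = "bernoulli_convolution l"
  interpret prob_space ?\<mu> by (rule prob_space_bernoulli_convolution)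
  \<comment> \<open>The constant may be negative here, while the Frostman construction needs a
    nonnegative one.\<close>
  have H: "\<bar>(\<integral>y. \<phi> y \<partial>bernoulli_convolution x) - (\<integral>y. \<phi> y \<partial>bernoulli_convolution l)\<bar>
        \<le> \<bar>C\<bar> * (x - l) * holder_norm \<theta> \<phi>" if "l < x" "x < l + e0" "\<phi> \<in> holder_space \<theta>" for x \<phi>
  proof -
    have "\<bar>(\<integral>y. \<phi> y \<partial>bernoulli_convolution x) - (\<integral>y. \<phi> y \<partial>bernoulli_convolution l)\<bar>
        \<le> C * (x - l) * holder_norm \<theta> \<phi>"
      using not that witness by force
    also have "\<dots> \<le> \<bar>C\<bar> * (x - l) * holder_norm \<theta> \<phi>"
      using that holder_norm_ge[OF that(3), of 0] by (intro mult_right_mono) auto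
    finally show ?thesis .
  qed
  obtain A where A: "A \<in> sets borel" "emeasure ?\<mu> A = 1" "hausdorff_dim A < 1"
    using dim unfolding upper_hausdorff_dim_measure_def INF_less_iff by auto
  then obtain s where s: "0 \<le> s" "hausdorff_measure s A = 0" "s < 1"
    unfolding hausdorff_dim_def INF_less_iff by auto
  define t where "t = (s + 1) / 2"
  have t: "0 < t" "t < 1" "s < t"
    using s by (auto simp: t_def)
  obtain G K r0 where G: "G \<in> sets borel" "measure ?\<mu> G > 0" "K > 0" "r0 > 0"
    "\<And>x r. x \<in> G \<Longrightarrow> 0 < r \<Longrightarrow> r \<le> r0 \<Longrightarrow> measure ?\<mu> (cball x r) \<le> K * r powr t"
    using frostman_of_holder_bound[OF l \<theta> e0 H abs_ge_zero t(1,2)] by blast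
  have "measure ?\<mu> (A \<inter> G) = 0"
    by (rule mass_distribution_null[OF prob_space_bernoulli_convolution sets_bernoulli_convolution
          G(1) A(1) G(3,4) s(1) t(3) G(5) s(2)])
  moreover have "measure ?\<mu> (A \<inter> G) = measure ?\<mu> G"
  proof (rule finite_measure_eq_AE)
    have "AE x in ?\<mu>. x \<in> A"
      using A by (intro AE_prob_1) (simp add: emeasure_eq_measure)
    then show "AE x in ?\<mu>. (x \<in> A \<inter> G) = (x \<in> G)"
      by eventually_elim auto
  qed (use A G in auto)
  ultimately show False
    using G(2) by simp
qed

section \<open>Completeness and genericity\<close>

lemma holder_norm_ge_quotient:
  assumes "\<phi> \<in> holder_space \<theta>"
  shows "\<bar>\<phi> x - \<phi> y\<bar> \<le> holder_norm \<theta> \<phi> * \<bar>x - y\<bar> powr \<theta>"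
proof (cases "x = y")
  case False
  have "\<bar>\<phi> x - \<phi> y\<bar> / \<bar>x - y\<bar> powr \<theta>
      \<le> (SUP (x, y) \<in> {(x, y). x \<noteq> y}. \<bar>\<phi> x - \<phi> y\<bar> / \<bar>x - y\<bar> powr \<theta>)"
    using cSUP_upper[OF _ holder_space_bdd(2)[OF assms], of "(x, y)"] False by simp
  moreover have "0 \<le> (SUP x. \<bar>\<phi> x\<bar>)"
    using cSUP_upper[OF UNIV_I holder_space_bdd(1)[OF assms], of 0] by linarith
  ultimately have "\<bar>\<phi> x - \<phi> y\<bar> / \<bar>x - y\<bar> powr \<theta> \<le> holder_norm \<theta> \<phi>"
    unfolding holder_norm_def by linarith
  then show ?thesis
    using False by (simp add: field_simps)
qed simp

lemma holder_dist_ge: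
  assumes "\<phi> \<in> holder_space \<theta>" "\<psi> \<in> holder_space \<theta>"
  shows "\<bar>\<phi> x - \<psi> x\<bar> \<le> holder_dist \<theta> \<phi> \<psi>"
    and "\<bar>(\<phi> x - \<psi> x) - (\<phi> y - \<psi> y)\<bar> \<le> holder_dist \<theta> \<phi> \<psi> * \<bar>x - y\<bar> powr \<theta>"
  using holder_norm_ge[OF holder_space_diff[OF assms]] holder_norm_ge_quotient[OF holder_space_diff[OF assms]] assms
  by (auto simp: holder_dist_def)

lemma mcomplete_holder: "Metric_space.mcomplete (holder_space \<theta>) (holder_dist \<theta>)"
proof -
  interpret Metric_space "holder_space \<theta>" "holder_dist \<theta>"
    by (rule Metric_space_holder)
  show ?thesis
    unfolding mcomplete_def
  proof (intro allI impI)
    fix \<sigma> assume "MCauchy \<sigma>"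
    then have \<sigma>: "\<And>n. \<sigma> n \<in> holder_space \<theta>"
      and cauchy: "\<And>e. e > 0 \<Longrightarrow> \<exists>N. \<forall>n m. N \<le> n \<longrightarrow> N \<le> m \<longrightarrow> holder_dist \<theta> (\<sigma> n) (\<sigma> m) < e"
      unfolding MCauchy_def by auto
    have "Cauchy (\<lambda>n. \<sigma> n x)" for x
    proof (rule metric_CauchyI)
      fix e :: real assume "e > 0"
      then obtain N where "\<forall>n m. N \<le> n \<longrightarrow> N \<le> m \<longrightarrow> holder_dist \<theta> (\<sigma> n) (\<sigma> m) < e"
        using cauchy by blast
      then show "\<exists>N. \<forall>m\<ge>N. \<forall>n\<ge>N. dist (\<sigma> m x) (\<sigma> n x) < e"
        using holder_dist_ge(1)[OF \<sigma> \<sigma>, of _ x] unfolding dist_real_def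
        by (meson order_le_less_trans)
    qed
    then have "\<exists>y. (\<lambda>n. \<sigma> n x) \<longlonglongrightarrow> y" for x
      by (simp add: Cauchy_convergent_iff convergent_def)
    then obtain \<phi> where lim: "\<And>x. (\<lambda>n. \<sigma> n x) \<longlonglongrightarrow> \<phi> x"
      by metis
    \<comment> \<open>Pointwise bounds pass to the limit in the second index. The supremum and the
      quotient part of the norm are each at most \<open>e\<close>, hence \<open>2 * e\<close>, and
      hence \<open>e / 3\<close> in the final estimate.\<close>
    have close: "(\<lambda>x. \<sigma> n x - \<phi> x) \<in> holder_space \<theta> \<and> holder_norm \<theta> (\<lambda>x. \<sigma> n x - \<phi> x) \<le> 2 * e"
      if N: "\<And>n m. N \<le> n \<Longrightarrow> N \<le> m \<Longrightarrow> holder_dist \<theta> (\<sigma> n) (\<sigma> m) < e" and n: "N \<le> n" for e N n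
    proof -
      have "\<bar>\<sigma> n x - \<phi> x\<bar> \<le> e" for x
      proof (rule tendsto_upperbound)
        show "(\<lambda>m. \<bar>\<sigma> n x - \<sigma> m x\<bar>) \<longlonglongrightarrow> \<bar>\<sigma> n x - \<phi> x\<bar>"
          by (intro tendsto_intros lim)
        show "\<forall>\<^sub>F m in sequentially. \<bar>\<sigma> n x - \<sigma> m x\<bar> \<le> e"
          using eventually_ge_at_top[of N]
        proof eventually_elim
          case (elim m)
          then show ?case
            using holder_dist_ge(1)[OF \<sigma> \<sigma>, of n x m] N[OF n elim] by linarith
        qed
      qed simp
      moreover have "\<bar>(\<sigma> n x - \<phi> x) - (\<sigma> n y - \<phi> y)\<bar> \<le> e * \<bar>x - y\<bar> powr \<theta>" for x y
      proof (rule tendsto_upperbound)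
        show "(\<lambda>m. \<bar>(\<sigma> n x - \<sigma> m x) - (\<sigma> n y - \<sigma> m y)\<bar>) \<longlonglongrightarrow> \<bar>(\<sigma> n x - \<phi> x) - (\<sigma> n y - \<phi> y)\<bar>"
          by (intro tendsto_intros lim)
        show "\<forall>\<^sub>F m in sequentially. \<bar>(\<sigma> n x - \<sigma> m x) - (\<sigma> n y - \<sigma> m y)\<bar> \<le> e * \<bar>x - y\<bar> powr \<theta>"
          using eventually_ge_at_top[of N]
        proof eventually_elim
          case (elim m)
          have "holder_dist \<theta> (\<sigma> n) (\<sigma> m) * \<bar>x - y\<bar> powr \<theta> \<le> e * \<bar>x - y\<bar> powr \<theta>"
            using N[OF n elim] by (intro mult_right_mono) auto
          then show ?case
            using holder_dist_ge(2)[OF \<sigma> \<sigma>, of n x m y] by linarith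
        qed
      qed simp
      ultimately show ?thesis
        using holder_norm_le[where \<phi> = "\<lambda>x. \<sigma> n x - \<phi> x" and b = e and c = e and \<theta> = \<theta>] by simp
    qed
    have \<phi>: "\<phi> \<in> holder_space \<theta>"
    proof -
      obtain N where "\<forall>n m. N \<le> n \<longrightarrow> N \<le> m \<longrightarrow> holder_dist \<theta> (\<sigma> n) (\<sigma> m) < 1"
        using cauchy[of 1] by auto
      then have "(\<lambda>x. \<sigma> N x - \<phi> x) \<in> holder_space \<theta>"
        using close[of N 1 N] by auto
      then have "(\<lambda>x. \<sigma> N x - (\<sigma> N x - \<phi> x)) \<in> holder_space \<theta>"
        by (rule holder_space_diff[OF \<sigma>])
      then show ?thesis by simp
    qed
    have "limitin mtopology \<sigma> \<phi> sequentially"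
      unfolding limit_metric_sequentially
    proof (intro conjI allI impI)
      fix e :: real assume "e > 0"
      then obtain N where N: "\<forall>n m. N \<le> n \<longrightarrow> N \<le> m \<longrightarrow> holder_dist \<theta> (\<sigma> n) (\<sigma> m) < e / 3"
        using cauchy[of "e / 3"] by auto
      have "\<sigma> n \<in> holder_space \<theta> \<and> holder_dist \<theta> (\<sigma> n) \<phi> < e" if "n \<ge> N" for n
        using close[of N "e / 3" n] N that \<sigma> \<phi> \<open>e > 0\<close> by (auto simp: holder_dist_def)
      then show "\<exists>N. \<forall>n\<ge>N. \<sigma> n \<in> holder_space \<theta> \<and> holder_dist \<theta> (\<sigma> n) \<phi> < e"
        by blast
    qed (rule \<phi>)
    then show "\<exists>\<phi>. limitin mtopology \<sigma> \<phi> sequentially"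
      by blast
  qed
qed

text \<open>The factor 2 comes from bounding each of the two parts of the norm by the whole norm;
  only the order of magnitude matters for the density argument.\<close>

lemma holder_space_scale:
  assumes "\<phi> \<in> holder_space \<theta>" "k \<ge> 0"
  shows "(\<lambda>x. k * \<phi> x) \<in> holder_space \<theta>" "holder_norm \<theta> (\<lambda>x. k * \<phi> x) \<le> 2 * k * holder_norm \<theta> \<phi>"
proof -
  have 1: "\<bar>k * \<phi> x\<bar> \<le> k * holder_norm \<theta> \<phi>" for x
    using holder_norm_ge[OF assms(1), of x] assms(2) by (simp add: abs_mult mult_left_mono)
  have 2: "\<bar>k * \<phi> x - k * \<phi> y\<bar> \<le> (k * holder_norm \<theta> \<phi>) * \<bar>x - y\<bar> powr \<theta>" for x y
  proof -
    have "k * \<bar>\<phi> x - \<phi> y\<bar> \<le> k * (holder_norm \<theta> \<phi> * \<bar>x - y\<bar> powr \<theta>)"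
      using holder_norm_ge_quotient[OF assms(1), of x y] assms(2) by (rule mult_left_mono)
    then show ?thesis
      using assms(2) by (simp add: right_diff_distrib[symmetric] abs_mult mult.assoc)
  qed
  show "(\<lambda>x. k * \<phi> x) \<in> holder_space \<theta>" "holder_norm \<theta> (\<lambda>x. k * \<phi> x) \<le> 2 * k * holder_norm \<theta> \<phi>"
    using holder_norm_le[OF 1 2] by auto
qed

section \<open>Functions with steep difference quotients\<close>

lemma holder_integral_dist:
  assumes "\<phi> \<in> holder_space \<theta>" "\<psi> \<in> holder_space \<theta>" "\<theta> > 0"
  shows "\<bar>(\<integral>y. \<phi> y \<partial>bernoulli_convolution x) - (\<integral>y. \<psi> y \<partial>bernoulli_convolution x)\<bar> \<le> holder_dist \<theta> \<phi> \<psi>"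
proof -
  interpret prob_space "bernoulli_convolution x"
    by (rule prob_space_bernoulli_convolution)
  have int: "integrable (bernoulli_convolution x) \<phi>" "integrable (bernoulli_convolution x) \<psi>"
    using holder_space_integrable assms by auto
  have "\<bar>\<integral>y. \<phi> y - \<psi> y \<partial>bernoulli_convolution x\<bar> \<le> (\<integral>y. \<bar>\<phi> y - \<psi> y\<bar> \<partial>bernoulli_convolution x)"
    by (rule integral_abs_bound)
  also have "\<dots> \<le> (\<integral>y. holder_dist \<theta> \<phi> \<psi> \<partial>bernoulli_convolution x)"
    using int holder_dist_ge(1)[OF assms(1,2)] by (intro integral_mono) auto
  finally show ?thesis
    using int by (simp add: prob_space)
qed

text \<open>One parameter \<open>c\<close> controls both steepness and closeness to l, so membership
  for arbitrarily large \<open>c\<close> forces unbounded difference quotients as x decreases to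
  l.\<close>

definition steep_set :: "real \<Rightarrow> real \<Rightarrow> real \<Rightarrow> (real \<Rightarrow> real) set" where
  "steep_set \<theta> l c = {\<phi> \<in> holder_space \<theta>. \<exists>x. l < x \<and> x < l + 1 / c \<and> x < 1 \<and>
     c * (x - l) < \<bar>(\<integral>y. \<phi> y \<partial>bernoulli_convolution x) - (\<integral>y. \<phi> y \<partial>bernoulli_convolution l)\<bar>}"

lemma openin_steep_set:
  assumes "\<theta> > 0"
  shows "openin (holder_topology \<theta>) (steep_set \<theta> l c)"
proof -
  interpret Metric_space "holder_space \<theta>" "holder_dist \<theta>"
    by (rule Metric_space_holder)
  show ?thesis
    unfolding holder_topology_def openin_mtopology
  proof (intro conjI allI impI)
    fix \<phi> assume "\<phi> \<in> steep_set \<theta> l c"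
    then obtain x where \<phi>: "\<phi> \<in> holder_space \<theta>" and x: "l < x" "x < l + 1 / c" "x < 1"
      "c * (x - l) < \<bar>(\<integral>y. \<phi> y \<partial>bernoulli_convolution x) - (\<integral>y. \<phi> y \<partial>bernoulli_convolution l)\<bar>"
      by (auto simp: steep_set_def)
    \<comment> \<open>Half of the slack: each of the two integrals moves by less than
      \<open>g\<close>.\<close>
    define g where "g = (\<bar>(\<integral>y. \<phi> y \<partial>bernoulli_convolution x) - (\<integral>y. \<phi> y \<partial>bernoulli_convolution l)\<bar> - c * (x - l)) / 2"
    have "mball \<phi> g \<subseteq> steep_set \<theta> l c"
    proof
      fix \<psi> assume "\<psi> \<in> mball \<phi> g"
      then have \<psi>: "\<psi> \<in> holder_space \<theta>" "holder_dist \<theta> \<phi> \<psi> < g"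
        by (auto simp: mball_def)
      have "c * (x - l) < \<bar>(\<integral>y. \<psi> y \<partial>bernoulli_convolution x) - (\<integral>y. \<psi> y \<partial>bernoulli_convolution l)\<bar>"
        using holder_integral_dist[OF \<phi> \<psi>(1) assms, of x] holder_integral_dist[OF \<phi> \<psi>(1) assms, of l] \<psi>(2)
        unfolding g_def by (simp add: field_simps abs_if split: if_splits)
      then show "\<psi> \<in> steep_set \<theta> l c"
        using \<psi> x by (auto simp: steep_set_def)
    qed
    moreover have "g > 0"
      using x by (simp add: g_def)
    ultimately show "\<exists>r>0. mball \<phi> r \<subseteq> steep_set \<theta> l c"
      by blast
  qed (auto simp: steep_set_def)
qed

lemma dense_steep_set:
  assumes l: "0 < l" "l < 1" and \<theta>: "0 < \<theta>" "\<theta> < 1" and c: "c > 0"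
    and dim: "upper_hausdorff_dim_measure (bernoulli_convolution l) < 1"
  shows "holder_topology \<theta> closure_of steep_set \<theta> l c = holder_space \<theta>"
proof -
  interpret Metric_space "holder_space \<theta>" "holder_dist \<theta>"
    by (rule Metric_space_holder)
  let ?h = "\<lambda>\<phi> x. \<integral>y. \<phi> y \<partial>bernoulli_convolution x"
  have "\<exists>\<xi>\<in>steep_set \<theta> l c. \<xi> \<in> mball \<psi> r" if \<psi>: "\<psi> \<in> holder_space \<theta>" and r: "r > 0" for \<psi> r
  proof (cases "\<psi> \<in> steep_set \<theta> l c")
    case True
    then show ?thesis
      using \<psi> r by (intro bexI[of _ \<psi>]) auto
  next
    case False
    define e0 where "e0 = min (1 / c) (1 - l)"
    have e0: "e0 > 0"
      using c l by (simp add: e0_def)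
    \<comment> \<open>The constant 8c/r is what the later scaling needs: k = r/(4n) turns it into
      slope 2c while moving \<psi> by at most r/2. As \<psi> is not steep, its increment is at most
      c (x - l) at every admissible x, in particular at the one obtained here, so slope above c
      remains after subtraction, whatever the signs.\<close>
    obtain x \<phi> where x: "l < x" "x < l + e0" and \<phi>: "\<phi> \<in> holder_space \<theta>"
      and steep: "8 * c / r * (x - l) * holder_norm \<theta> \<phi> < \<bar>?h \<phi> x - ?h \<phi> l\<bar>"
      using upper_dim_lt_1_no_holder_bound[OF l \<theta> e0 dim] by blast
    have xr: "x < l + 1 / c" "x < 1"
      using x by (auto simp: e0_def)
    have \<psi>_flat: "\<bar>?h \<psi> x - ?h \<psi> l\<bar> \<le> c * (x - l)"
      using False \<psi> x xr by (force simp: steep_set_def)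
    define n where "n = holder_norm \<theta> \<phi>"
    have "n \<noteq> 0"
    proof
      assume "n = 0"
      then have "\<phi> y = 0" for y
        using holder_norm_ge[OF \<phi>, of y] by (simp add: n_def)
      then show False
        using steep \<open>n = 0\<close> by (simp add: n_def)
    qed
    then have n: "n > 0"
      using holder_norm_ge[OF \<phi>, of 0] by (simp add: n_def)
    define k where "k = r / (4 * n)"
    have k: "k > 0"
      using r n by (simp add: k_def)
    define \<eta> where "\<eta> = (\<lambda>y. k * \<phi> y)"
    have \<eta>: "\<eta> \<in> holder_space \<theta>" "holder_norm \<theta> \<eta> \<le> 2 * k * n"
      unfolding \<eta>_def n_def using holder_space_scale[OF \<phi>, of k] k by auto
    define \<xi> where "\<xi> = (\<lambda>y. \<psi> y - \<eta> y)"
    have \<xi>: "\<xi> \<in> holder_space \<theta>"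
      unfolding \<xi>_def using \<psi> \<eta>(1) by (rule holder_space_diff)
    have "holder_dist \<theta> \<psi> \<xi> = holder_norm \<theta> \<eta>"
      using \<psi> \<xi> by (simp add: holder_dist_def \<xi>_def)
    also have "\<dots> \<le> r / 2"
      using \<eta>(2) n by (simp add: k_def)
    finally have ball: "\<xi> \<in> mball \<psi> r"
      using \<psi> \<xi> r by (simp add: mball_def)
    have h\<xi>: "?h \<xi> z = ?h \<psi> z - k * ?h \<phi> z" for z
      using holder_space_integrable[OF \<psi> \<theta>(1), of z] holder_space_integrable[OF \<phi> \<theta>(1), of z]
      by (simp add: \<xi>_def \<eta>_def)
    have "2 * c * (x - l) = k * (8 * c / r * (x - l) * n)"
      using r n by (simp add: k_def)
    also have "\<dots> < k * \<bar>?h \<phi> x - ?h \<phi> l\<bar>"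
      using steep k unfolding n_def by (intro mult_strict_left_mono)
    also have "\<dots> = \<bar>k * ?h \<phi> x - k * ?h \<phi> l\<bar>"
      using k by (simp add: right_diff_distrib[symmetric] abs_mult)
    finally have "c * (x - l) < \<bar>?h \<xi> x - ?h \<xi> l\<bar>"
      using \<psi>_flat unfolding h\<xi> by linarith
    then show ?thesis
      using ball \<xi> x xr by (intro bexI[of _ \<xi>]) (auto simp: steep_set_def)
  qed
  then show ?thesis
    unfolding holder_topology_def metric_closure_of by auto
qed

lemma steep_sets_not_differentiable:
  assumes l: "0 < l" "l < 1" and steep: "\<And>n::nat. \<phi> \<in> steep_set \<theta> l (real (Suc n))"
  shows "\<not> (\<lambda>x. \<integral>y. \<phi> y \<partial>bernoulli_convolution x) differentiable (at l within {0<..<1})"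
proof
  let ?h = "\<lambda>x. \<integral>y. \<phi> y \<partial>bernoulli_convolution x"
  assume "?h differentiable (at l within {0<..<1})"
  then obtain D where "(?h has_field_derivative D) (at l within {0<..<1})"
    by (auto simp: real_differentiable_def)
  then have "((\<lambda>x. (?h x - ?h l) / (x - l)) \<longlongrightarrow> D) (at l within {0<..<1})"
    by (simp add: has_field_derivative_iff)
  then have "\<forall>\<^sub>F x in at l within {0<..<1}. dist ((?h x - ?h l) / (x - l)) D < 1"
    by (rule tendstoD) simp
  then obtain d where d: "d > 0"
    "\<And>x. x \<in> {0<..<1} \<Longrightarrow> x \<noteq> l \<Longrightarrow> dist x l < d \<Longrightarrow> dist ((?h x - ?h l) / (x - l)) D < 1"
    unfolding eventually_at by blast
  \<comment> \<open>The index has two tasks: 1/(n+1) < d puts the steep point into the neighbourhood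
    given by differentiability, and n > |D| + 1 contradicts the quotient bound there.\<close>
  obtain n :: nat where n: "max (1 / d) (\<bar>D\<bar> + 1) < real n"
    using reals_Archimedean2 by blast
  obtain x where x: "l < x" "x < l + 1 / real (Suc n)" "x < 1" "real (Suc n) * (x - l) < \<bar>?h x - ?h l\<bar>"
    using steep[of n] by (auto simp: steep_set_def)
  have "1 / d < real (Suc n)"
    using n by simp
  then have "1 / real (Suc n) < d"
    using d(1) by (simp add: field_simps)
  then have "dist ((?h x - ?h l) / (x - l)) D < 1"
    using d(2)[of x] x l by (auto simp: dist_real_def)
  then have "\<bar>(?h x - ?h l) / (x - l)\<bar> < \<bar>D\<bar> + 1"
    unfolding dist_real_def by linarith
  moreover have "real (Suc n) < \<bar>(?h x - ?h l) / (x - l)\<bar>"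
    using x by (simp add: abs_divide pos_less_divide_eq)
  ultimately show False
    using n by simp
qed

theorem theorem1p2:
  fixes l\<^sub>0 :: real
  assumes "l\<^sub>0 \<in> {0<..<1}"
    and "upper_hausdorff_dim_measure (bernoulli_convolution l\<^sub>0) < 1"
  shows "\<forall>\<theta>\<in>{0<..<1}. generic_in (holder_topology \<theta>)
    (\<lambda>\<phi>. \<not> (\<lambda>l. \<integral>x. \<phi> x \<partial>bernoulli_convolution l) differentiable (at l\<^sub>0 within {0<..<1}))"
proof
  fix \<theta> :: real assume "\<theta> \<in> {0<..<1}"
  then have \<theta>: "0 < \<theta>" "\<theta> < 1"
    by auto
  have l: "0 < l\<^sub>0" "l\<^sub>0 < 1"
    using assms by auto
  interpret Metric_space "holder_space \<theta>" "holder_dist \<theta>"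
    by (rule Metric_space_holder)
  let ?V = "\<lambda>n. steep_set \<theta> l\<^sub>0 (real (Suc n))"
  define G where "G = (\<Inter>n. ?V n)"
  have open_V: "openin (holder_topology \<theta>) (?V n)" for n
    by (rule openin_steep_set[OF \<theta>(1)])
  have "gdelta_in (holder_topology \<theta>) G"
    unfolding G_def using open_V by (intro gdelta_in_Inter open_imp_gdelta_in) auto
  moreover have "holder_topology \<theta> closure_of G = holder_space \<theta>"
    unfolding G_def holder_topology_def
  proof (rule metric_Baire_category[OF mcomplete_holder])
    fix T assume "T \<in> range ?V"
    then show "openin mtopology T \<and> mtopology closure_of T = holder_space \<theta>"
      using open_V dense_steep_set[OF l \<theta> _ assms(2)] unfolding holder_topology_def by auto
  qed simp
  moreover have "G \<subseteq> {\<phi> \<in> holder_space \<theta>.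
      \<not> (\<lambda>l. \<integral>x. \<phi> x \<partial>bernoulli_convolution l) differentiable (at l\<^sub>0 within {0<..<1})}"
  proof
    fix \<phi> assume "\<phi> \<in> G"
    then have V: "\<phi> \<in> ?V n" for n
      by (simp add: G_def)
    then show "\<phi> \<in> {\<phi> \<in> holder_space \<theta>.
      \<not> (\<lambda>l. \<integral>x. \<phi> x \<partial>bernoulli_convolution l) differentiable (at l\<^sub>0 within {0<..<1})}"
      using steep_sets_not_differentiable[OF l V] V[of 0] by (simp add: steep_set_def)
  qed
  ultimately show "generic_in (holder_topology \<theta>)
    (\<lambda>\<phi>. \<not> (\<lambda>l. \<integral>x. \<phi> x \<partial>bernoulli_convolution l) differentiable (at l\<^sub>0 within {0<..<1}))"
    unfolding generic_in_def topspace_holder_topology by blast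
qed

end
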